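(* Let $N\ge3$ be an integer, let $\frac N{N-2}\le p\le\frac{N+2}{N-2}$, and let $u$ be a singular positive solution of $$u''+\Big(\frac{N-1}{r}+\frac r2\Big)u'+\frac1{p-1}u+u^p=0,\qquad r>0.\qquad (E)$$ Then the limit $\ell=\lim_{r\to\infty}r^{2/(p-1)}u(r)$ (which exists and is finite) satisfies $0\le\ell\le\ell^*$.
   Context: A singular positive solution of $(E)$ is a function $u\in C^2(0,\infty)$ with $u(r)>0$ for all $r>0$, satisfying $(E)$ for all $r>0$, and $u(r)\to\infty$ as $r\to0$. It is known that for such $u$ the limit $\lim_{r\to\infty}r^{2/(p-1)}u(r)$ exists and is finite. For each $\ell>0$, $S_\ell$ denotes the set of positive solutions $u\in C^2(0,\infty)\cap C^1[0,\infty)$ of $(E)$ such that $u'(0)=0$ and $\lim_{r\to\infty}r^{2/(p-1)}u(r)=\ell$. Define $$\ell^*=\sup\{\ell>0:\ S_\ell\ne\emptyset\}.$$ It is known that $0<\ell^*<\infty$ if $p>(N+2)/N$. *)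

theory Defs
  imports "HOL-Analysis.Analysis"
begin

text \<open>Functions on \<open>(0,\<infinity>)\<close> or \<open>[0,\<infinity>)\<close> are represented by total functions on the reals, whose
  values outside the domain are irrelevant. \<open>C1_deriv_on u v S\<close> says that \<open>u\<close> is \<open>C\<^sup>1\<close> on \<open>S\<close> with
  derivative \<open>v\<close>; at \<open>0\<close> in \<open>{0..}\<close> the derivative is the one-sided one.\<close>

definition C1_deriv_on :: "(real \<Rightarrow> real) \<Rightarrow> (real \<Rightarrow> real) \<Rightarrow> real set \<Rightarrow> bool" where
  "C1_deriv_on u v S \<longleftrightarrow>
     (\<forall>r\<in>S. (u has_real_derivative v r) (at r within S)) \<and> continuous_on S v"

definition positive_solution :: "nat \<Rightarrow> real \<Rightarrow> (real \<Rightarrow> real) \<Rightarrow> bool" where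
  "positive_solution N p u \<longleftrightarrow>
     (\<forall>r>0. u r > 0) \<and>
     (\<exists>u' u''. C1_deriv_on u u' {0<..} \<and> C1_deriv_on u' u'' {0<..} \<and>
        (\<forall>r>0. u'' r + ((real N - 1) / r + r / 2) * u' r + 1 / (p - 1) * u r + u r powr p = 0))"

definition singular_positive_solution :: "nat \<Rightarrow> real \<Rightarrow> (real \<Rightarrow> real) \<Rightarrow> bool" where
  "singular_positive_solution N p u \<longleftrightarrow>
     positive_solution N p u \<and> filterlim u at_top (at_right 0)"

definition decays_to :: "real \<Rightarrow> (real \<Rightarrow> real) \<Rightarrow> real \<Rightarrow> bool" where
  "decays_to p u l \<longleftrightarrow> ((\<lambda>r. r powr (2 / (p - 1)) * u r) \<longlongrightarrow> l) at_top"

definition S_set :: "nat \<Rightarrow> real \<Rightarrow> real \<Rightarrow> (real \<Rightarrow> real) set" where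
  "S_set N p l =
     {u. positive_solution N p u \<and> u 0 > 0 \<and>
         (\<exists>u'. C1_deriv_on u u' {0..} \<and> u' 0 = 0) \<and> decays_to p u l}"

text \<open>The supremum is taken in the extended reals, so no finiteness or nonemptiness is presupposed.\<close>

definition ell_star :: "nat \<Rightarrow> real \<Rightarrow> ereal" where
  "ell_star N p = Sup (ereal ` {l. l > 0 \<and> S_set N p l \<noteq> {}})"

end

theory Submission
  imports Defs
begin

text \<open>
  Let \<open>L u = u'' + ((N - 1) / r + r / 2) u'\<close> and \<open>k = 1 / (p - 1)\<close>. A singular solution \<open>u\<close> decreases,
  and for \<open>K > 1\<close> the function \<open>v = (K u powr (-1/k) + (K - 1) / k) powr (-k)\<close> is a bounded, decreasing
  supersolution with \<open>r powr (2 k) * v r \<longlongrightarrow> K powr (-k) * l\<close>. An explicit subsolution below \<open>v\<close>,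
  with any smaller positive limit \<open>l'\<close>, yields a regular solution in between, as a fixed point
  (Knaster--Tarski) of the monotone integral operator that inverts \<open>- L\<close>. The weighted limit of that
  solution exists and is at least \<open>l'\<close>, so \<open>l' \<le> ell_star\<close>; now let \<open>l'\<close> tend to \<open>K powr (-k) * l\<close> and
  \<open>K\<close> to \<open>1\<close>. If \<open>l = 0\<close>, an explicit small supersolution shows that the supremum is not over the empty set.
\<close>

text \<open>A singular \<open>u\<close> satisfies \<open>L u = - G u\<close> with
  \<open>G x = k x + x powr p\<close>, but it is unbounded at \<open>0\<close>, so it cannot itself
  bound a regular solution from above. The formula for \<open>v\<close> comes from the flow of
  \<open>y' = G y\<close>, which multiplies \<open>y powr (-1/k) + 1/k\<close> by
  \<open>exp (-t)\<close>. Running it backwards until that factor is \<open>K\<close> gives a map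
  \<open>Phi\<close>, and \<open>v = Phi u\<close>. A flow commutes with its own vector field,
  \<open>G (Phi y) = Phi' y * G y\<close>, and \<open>Phi\<close> is increasing, concave and
  bounded; hence \<open>L v = Phi' u * L u + Phi'' u * u'\<^sup>2 <= - G v\<close>. The only price
  is the factor \<open>K powr (-k)\<close> at infinity, because \<open>Phi y\<close> behaves like
  \<open>K powr (-k) * y\<close> for small \<open>y\<close>. The fixed point is found by order
  alone, so it comes without continuity or decay. Its regularity is bootstrapped from monotonicity,
  and its decay from an energy argument valid for every positive solution, which also supplies the
  limit for \<open>u\<close>.\<close>

section \<open>Preliminaries on limits, integrals and powers\<close>

lemma antimono_bounded_below_tendsto:
  fixes f :: "real \<Rightarrow> real"
  assumes anti: "\<And>x y. R \<le> x \<Longrightarrow> x \<le> y \<Longrightarrow> f y \<le> f x" and bd: "\<And>x. R \<le> x \<Longrightarrow> B \<le> f x"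
  obtains l where "(f \<longlongrightarrow> l) at_top"
proof
  have bdd: "bdd_below (f ` {R..})" using bd by (auto intro!: bdd_belowI[of _ B])
  show "(f \<longlongrightarrow> Inf (f ` {R..})) at_top"
  proof (rule order_tendstoI)
    fix a assume "a < Inf (f ` {R..})"
    then show "eventually (\<lambda>x. a < f x) at_top"
      by (intro eventually_at_top_linorderI[of R]) (meson atLeast_iff bdd cInf_lower image_eqI less_le_trans)
  next
    fix a assume "Inf (f ` {R..}) < a"
    then obtain x where x: "x \<ge> R" "f x < a"
      using cInf_lessD[of "f ` {R..}" a] by auto
    then show "eventually (\<lambda>x. f x < a) at_top"
      by (intro eventually_at_top_linorderI[of x]) (meson anti le_less_trans)
  qed
qed

lemma nn_integral_has_real_derivative_nonneg:
  fixes P P' :: "real \<Rightarrow> real"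
  assumes "a \<le> b" "\<And>x. a \<le> x \<Longrightarrow> x \<le> b \<Longrightarrow> (P has_real_derivative P' x) (at x)"
    "\<And>x. a \<le> x \<Longrightarrow> x \<le> b \<Longrightarrow> 0 \<le> P' x"
  shows "(\<integral>\<^sup>+x\<in>{a..b}. ennreal (P' x) \<partial>lborel) = ennreal (P b - P a)"
    and "(\<integral>\<^sup>+x\<in>{a<..<b}. ennreal (P' x) \<partial>lborel) = ennreal (P b - P a)"
proof -
  have "(P' has_integral P b - P a) {a..b}"
    using assms by (intro fundamental_theorem_of_calculus)
      (simp_all add: has_real_derivative_iff_has_vector_derivative[symmetric] has_field_derivative_at_within)
  with assms(3) show "(\<integral>\<^sup>+x\<in>{a..b}. ennreal (P' x) \<partial>lborel) = ennreal (P b - P a)"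
    and "(\<integral>\<^sup>+x\<in>{a<..<b}. ennreal (P' x) \<partial>lborel) = ennreal (P b - P a)"
    by (auto intro!: nn_integral_has_integral_lebesgue' simp: has_integral_Icc_iff_Ioo[symmetric])
qed

text \<open>\<open>P'\<close> may be negative, where \<open>ennreal\<close> truncates it to
  \<open>0\<close>. The comparison with \<open>f\<close> is therefore made between real integrals,
  and only the integral of \<open>f\<close> is turned into a nonnegative one.\<close>

lemma nn_integral_ge_derivative:
  fixes P P' f :: "real \<Rightarrow> real"
  assumes "a \<le> b" "\<And>x. a \<le> x \<Longrightarrow> x \<le> b \<Longrightarrow> (P has_real_derivative P' x) (at x)"
    "\<And>x. a \<le> x \<Longrightarrow> x \<le> b \<Longrightarrow> P' x \<le> f x" "\<And>x. a \<le> x \<Longrightarrow> x \<le> b \<Longrightarrow> 0 \<le> f x"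
    "continuous_on {a..b} f"
  shows "ennreal (P b - P a) \<le> (\<integral>\<^sup>+x\<in>{a<..<b}. ennreal (f x) \<partial>lborel)"
proof -
  have 1: "(P' has_integral P b - P a) {a..b}"
    using assms by (intro fundamental_theorem_of_calculus)
      (simp_all add: has_real_derivative_iff_has_vector_derivative[symmetric] has_field_derivative_at_within)
  have 2: "(f has_integral integral {a..b} f) {a..b}"
    using assms(5) by (intro integrable_integral integrable_continuous_real)
  have "P b - P a \<le> integral {a..b} f"
    using assms(3) by (intro has_integral_le[OF 1 2]) simp
  moreover have "(\<integral>\<^sup>+x\<in>{a<..<b}. ennreal (f x) \<partial>lborel) = ennreal (integral {a..b} f)"
    using 2 assms(4) by (intro nn_integral_has_integral_lebesgue') (simp_all add: has_integral_Icc_iff_Ioo[symmetric])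
  ultimately show ?thesis by (simp add: ennreal_leI)
qed

lemma nn_integral_set_mono:
  fixes f :: "'a \<Rightarrow> ennreal"
  assumes "A \<subseteq> B" shows "(\<integral>\<^sup>+x\<in>A. f x \<partial>M) \<le> (\<integral>\<^sup>+x\<in>B. f x \<partial>M)"
  using assms by (intro nn_integral_mono) (auto split: split_indicator)

text \<open>Monotone convergence for sets: bounds obtained from the fundamental theorem on compact
  intervals pass to intervals that reach \<open>0\<close> or infinity.\<close>

lemma nn_integral_UN_le:
  fixes f :: "'a \<Rightarrow> ennreal"
  assumes meas: "\<And>n. (\<lambda>x. f x * indicator (A n) x) \<in> borel_measurable M"
    and inc: "incseq A" and le: "\<And>n::nat. (\<integral>\<^sup>+x\<in>A n. f x \<partial>M) \<le> c"
  shows "(\<integral>\<^sup>+x\<in>(\<Union>n. A n). f x \<partial>M) \<le> c"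
proof -
  have "f x * indicator (\<Union>n. A n) x = (SUP n. f x * indicator (A n) x)" for x
  proof (rule antisym)
    show "f x * indicator (\<Union>n. A n) x \<le> (SUP n. f x * indicator (A n) x)"
    proof (cases "x \<in> (\<Union>n. A n)")
      case True
      then obtain n where "x \<in> A n" by auto
      then show ?thesis using True by (intro SUP_upper2[of n]) auto
    qed auto
  qed (auto intro!: SUP_least mult_left_mono simp: indicator_def)
  then have "(\<integral>\<^sup>+x\<in>(\<Union>n. A n). f x \<partial>M) = (\<integral>\<^sup>+x. (SUP n. f x * indicator (A n) x) \<partial>M)" by simp
  also have "\<dots> = (SUP n. \<integral>\<^sup>+x\<in>A n. f x \<partial>M)"
    using inc by (intro nn_integral_monotone_convergence_SUP meas)
      (auto intro!: incseq_SucI le_funI mult_left_mono simp: indicator_def intro: subsetD[OF incseq_SucD])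
  also have "\<dots> \<le> c" by (intro SUP_least le)
  finally show ?thesis .
qed

lemma borel_measurable_ennreal_indicator_continuous_on:
  fixes f :: "real \<Rightarrow> real"
  assumes "continuous_on {a..b} f"
  shows "(\<lambda>x. ennreal (f x) * indicator {a..b} x) \<in> borel_measurable lborel"
proof -
  have "(\<lambda>x. ennreal (indicator {a..b} x *\<^sub>R f x)) \<in> borel_measurable borel"
    using assms by (intro measurable_compose[OF borel_measurable_continuous_on_indicator measurable_ennreal]) auto
  moreover have "(\<lambda>x. ennreal (indicator {a..b} x *\<^sub>R f x)) = (\<lambda>x. ennreal (f x) * indicator {a..b} x)"
    by (auto simp: indicator_def)
  ultimately show ?thesis by simp
qed

lemma DERIV_powr_const:
  assumes "(f has_real_derivative f') (at x)" "f x > 0"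
  shows "((\<lambda>x. f x powr c) has_real_derivative (c * (f x powr c * (f' / f x)))) (at x)"
  using DERIV_fun_powr[OF assms, of c] assms(2) by (simp add: powr_diff mult.assoc)

section \<open>Exponents and the pointwise form of the equation\<close>

locale ode_params =
  fixes N :: nat and p :: real
  assumes N_ge_3: "N \<ge> 3" and p_ge: "real N / (real N - 2) \<le> p"
begin

definition k :: real where "k = 1 / (p - 1)"

lemma p_gt_1: "p > 1"
proof -
  have "1 < real N / (real N - 2)" using N_ge_3 by (simp add: field_simps)
  then show ?thesis using p_ge by linarith
qed

lemma k_pos: "k > 0" using p_gt_1 by (simp add: k_def)

lemma two_k_eq: "2 / (p - 1) = 2 * k" by (simp add: k_def)

lemma p_eq: "p = 1 + 1 / k" using p_gt_1 by (simp add: k_def)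

lemma k_mult_p: "k * p = k + 1" using p_gt_1 by (simp add: k_def field_simps)

text \<open>The hypothesis \<open>N / (N - 2) <= p\<close> rewritten in terms of
  \<open>k\<close>.\<close>

lemma k_le: "2 * k + 2 \<le> real N"
proof -
  have "real N \<le> p * (real N - 2)" using p_ge N_ge_3 by (simp add: field_simps)
  then have "2 \<le> (p - 1) * (real N - 2)" by (simp add: algebra_simps)
  then show ?thesis using p_gt_1 by (simp add: k_def field_simps)
qed

definition G :: "real \<Rightarrow> real" where "G x = k * x + x powr p"

lemma positive_solutionE:
  assumes "positive_solution N p u"
  obtains u' u'' where "\<And>r. r > 0 \<Longrightarrow> u r > 0"
    "\<And>r. r > 0 \<Longrightarrow> (u has_real_derivative u' r) (at r)"
    "\<And>r. r > 0 \<Longrightarrow> (u' has_real_derivative u'' r) (at r)"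
    "\<And>r. r > 0 \<Longrightarrow> u'' r + ((real N - 1) / r + r / 2) * u' r + G (u r) = 0"
proof -
  from assms obtain u' u'' where *: "\<forall>r>0. u r > 0" "C1_deriv_on u u' {0<..}" "C1_deriv_on u' u'' {0<..}"
    "\<forall>r>0. u'' r + ((real N - 1) / r + r / 2) * u' r + 1 / (p - 1) * u r + u r powr p = 0"
    unfolding positive_solution_def by auto
  have at: "at r within {0<..} = at r" if "r > 0" for r :: real
    using that by (intro at_within_open) auto
  show ?thesis
  proof (rule that[of u' u''])
    show "(u has_real_derivative u' r) (at r)" "(u' has_real_derivative u'' r) (at r)" if "r > 0" for r
      using *(2,3) that unfolding C1_deriv_on_def at[OF that, symmetric] by auto
    show "u'' r + ((real N - 1) / r + r / 2) * u' r + G (u r) = 0" if "r > 0" for r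
      using *(4) that by (simp add: G_def k_def algebra_simps)
  qed (use *(1) in auto)
qed

section \<open>Existence of the weighted limit for every positive solution\<close>

text \<open>The radial Laplacian in dimension \<open>N\<close> maps \<open>r powr (- 2 * k)\<close>
  to \<open>- lam * r powr (- 2 * k - 2)\<close>.\<close>

definition lam :: real where "lam = 2 * k * (real N - 2 - 2 * k)"

lemma lam_nonneg: "lam \<ge> 0" using k_pos k_le by (simp add: lam_def)

text \<open>For \<open>z r = r powr (2 k) * u r\<close> the equation becomes
  \<open>z'' + ((N - 1 - 4 k) / r + r / 2) z' + (z\<^sup>p - lam z) / r\<^sup>2 = 0\<close>. The energy
  \<open>r\<^sup>2 z'\<^sup>2 / 2 - lam z\<^sup>2 / 2 + z powr (p + 1) / (p + 1)\<close> eventually decreases, which bounds \<open>z\<close> and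
  \<open>r z'\<close>, and then \<open>z + 2 z' / r\<close> has derivative \<open>O(r\<^sup>-\<^sup>3)\<close>.\<close>

lemma positive_solution_decays_to:
  assumes "positive_solution N p u"
  obtains l where "decays_to p u l" "0 \<le> l"
proof -
  from positive_solutionE[OF assms] obtain u' u'' where upos: "\<And>r. r > 0 \<Longrightarrow> u r > 0"
    and du: "\<And>r. r > 0 \<Longrightarrow> (u has_real_derivative u' r) (at r)"
    and du': "\<And>r. r > 0 \<Longrightarrow> (u' has_real_derivative u'' r) (at r)"
    and ode: "\<And>r. r > 0 \<Longrightarrow> u'' r + ((real N - 1) / r + r / 2) * u' r + G (u r) = 0" by metis
  define z where "z r = r powr (2*k) * u r" for r
  define z' where "z' r = r powr (2*k) * (u' r + 2 * k * u r / r)" for r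
  define m where "m = real N - 1 - 4 * k"
  have zpos: "z r > 0" if "r > 0" for r using upos[OF that] that by (simp add: z_def)
  have dz: "(z has_real_derivative z' r) (at r)" if "r > 0" for r
    unfolding z_def[abs_def] z'_def
    by (rule derivative_eq_intros du[OF that] refl | use that in \<open>simp; fail\<close>)+
       (use that in \<open>simp add: powr_diff field_simps\<close>)
  have zp: "z r powr p = r powr (2*k) * u r powr p * r\<^sup>2" if "r > 0" for r
  proof -
    have "2 * k * p = 2 * k + 2" using k_mult_p by simp
    then have "z r powr p = r powr (2*k + 2) * u r powr p"
      using that upos[OF that] by (simp add: z_def powr_mult powr_powr)
    then show ?thesis using that by (simp add: powr_add)
  qed
  have dz': "(z' has_real_derivative (- (m / r + r / 2) * z' r + (lam * z r - z r powr p) / r\<^sup>2)) (at r)"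
    if r: "r > 0" for r
  proof -
    have "(z' has_real_derivative (r powr (2*k) * (2*k/r) * (u' r + 2 * k * u r / r)
        + r powr (2*k) * (u'' r + 2 * k * u' r / r - 2 * k * u r / r\<^sup>2))) (at r)"
      unfolding z'_def[abs_def]
      by (rule derivative_eq_intros du[OF r] du'[OF r] refl | use r in \<open>simp; fail\<close>)+
         (use r in \<open>simp add: powr_diff field_simps power2_eq_square\<close>)
    moreover have "u'' r = - ((real N - 1) / r + r / 2) * u' r - k * u r - u r powr p"
      using ode[OF r] by (simp add: G_def algebra_simps)
    moreover have "r powr (2*k) * (2*k/r) * (u' r + 2 * k * u r / r)
        + r powr (2*k) * ((- ((real N - 1) / r + r / 2) * u' r - k * u r - u r powr p) + 2 * k * u' r / r - 2 * k * u r / r\<^sup>2)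
        = - (m / r + r / 2) * z' r + (lam * z r - z r powr p) / r\<^sup>2"
    proof -
      \<comment> \<open>Treating \<open>1 / r\<close> and \<open>r / 2\<close> as unknowns tied only
        by \<open>2 * h * i = 1\<close> leaves a polynomial identity.\<close>
      define i h where "i = 1 / r" and "h = r / 2"
      have ih: "2 * h * i = 1" using r by (simp add: i_def h_def)
      have 1: "(lam * z r - z r powr p) / r\<^sup>2 = r powr (2*k) * (lam * u r * i\<^sup>2 - u r powr p)"
        unfolding zp[OF r] using r by (simp add: z_def i_def right_diff_distrib diff_divide_distrib power_divide)
      have "2*k*i * (v1 + 2 * k * v0 * i)
        + ((- ((n - 1) * i + h) * v1 - k * v0 - w) + 2 * k * v1 * i - 2 * k * v0 * i\<^sup>2)
        = - ((n - 1 - 4 * k) * i + h) * (v1 + 2 * k * v0 * i) + (2 * k * (n - 2 - 2 * k) * v0 * i\<^sup>2 - w)"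
        for v0 v1 n w :: real
        using ih by algebra
      from this[of "u' r" "u r" "real N" "u r powr p"] have
        "(2*k/r) * (u' r + 2 * k * u r / r)
        + ((- ((real N - 1) / r + r / 2) * u' r - k * u r - u r powr p) + 2 * k * u' r / r - 2 * k * u r / r\<^sup>2)
        = - (m / r + r / 2) * (u' r + 2 * k * u r / r) + (lam * u r * i\<^sup>2 - u r powr p)"
        by (simp add: m_def lam_def i_def h_def power_divide)
      from arg_cong[OF this, of "\<lambda>x. r powr (2*k) * x"] show ?thesis
        unfolding 1 z'_def by (simp only: distrib_left mult.assoc mult.left_commute)
    qed
    ultimately show ?thesis by simp
  qed
  define E where "E r = (r * z' r)\<^sup>2 / 2 - lam * (z r)\<^sup>2 / 2 + z r powr (p + 1) / (p + 1)" for r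
  have dE: "(E has_real_derivative (r * (z' r)\<^sup>2 * (1 - m - r\<^sup>2 / 2))) (at r)" if r: "r > 0" for r
  proof -
    define w where "w = - (m / r + r / 2) * z' r + (lam * z r - z r powr p) / r\<^sup>2"
    have 1: "((\<lambda>r. z r powr (p + 1) / (p + 1)) has_real_derivative (z r powr p * z' r)) (at r)"
      using DERIV_cdivide[OF DERIV_fun_powr[OF dz[OF r] zpos[OF r], of "p + 1"], of "p + 1"] p_gt_1
      by simp
    have 2: "((\<lambda>r. (r * z' r)\<^sup>2 / 2) has_real_derivative (r * z' r * (z' r + r * w))) (at r)"
      using dz'[OF r, folded w_def] by (auto intro!: derivative_eq_intros simp: algebra_simps power2_eq_square)
    have 3: "((\<lambda>r. lam * (z r)\<^sup>2 / 2) has_real_derivative (lam * z r * z' r)) (at r)"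
      using dz[OF r] by (auto intro!: derivative_eq_intros)
    have "r * z' r * (z' r + r * w) - lam * z r * z' r + z r powr p * z' r
      = r * (z' r)\<^sup>2 * (1 - m - r\<^sup>2 / 2)"
      using r by (simp add: w_def field_simps power2_eq_square)
    with DERIV_add[OF DERIV_diff[OF 2 3] 1] show ?thesis
      unfolding E_def[abs_def] by simp
  qed
  obtain m1 where m1: "m1 \<ge> 0" "1 - m \<le> m1" using abs_ge_zero abs_ge_self by blast
  \<comment> \<open>For \<open>x >= R\<close> this gives
    \<open>x\<^sup>2 / 2 >= x / 2 >= m1 >= 1 - m\<close>, so the derivative of \<open>E\<close> is
    nonpositive there.\<close>
  define R where "R = 1 + 2 * m1"
  have R: "R \<ge> 1" using m1 by (simp add: R_def)
  have E_le: "E r \<le> E R" if "r \<ge> R" for r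
  proof (rule DERIV_nonpos_imp_nonincreasing[OF that])
    fix x assume x: "R \<le> x" "x \<le> r"
    have "x \<le> x\<^sup>2" using x R by (simp add: power2_eq_square)
    then have "1 - m - x\<^sup>2/2 \<le> 0" using x m1 unfolding R_def by (simp add: field_simps)
    then show "\<exists>y. (E has_real_derivative y) (at x) \<and> y \<le> 0"
      using dE[of x] x R by (intro exI conjI) (auto intro!: mult_nonneg_nonpos)
  qed
  \<comment> \<open>Since \<open>k * (p - 1) = 1\<close>, any \<open>z r > M\<close> has its power
    term at least \<open>(lam / 2 + 1) * (z r)\<^sup>2\<close>, which forces
    \<open>E r >= (z r)\<^sup>2\<close>; the decrease of \<open>E\<close> then bounds
    \<open>z\<close>.\<close>
  define M where "M = ((p + 1) * (lam / 2 + 1)) powr k"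
  have M: "z r \<le> max M (1 + \<bar>E R\<bar>)" if "r \<ge> R" for r
  proof (rule ccontr)
    assume "\<not> ?thesis"
    then have zr: "z r > M" "z r > 1 + \<bar>E R\<bar>" by auto
    have zz: "z r > 0" using zpos[of r] that R by simp
    have "M powr (p - 1) \<le> z r powr (p - 1)"
      using zr p_gt_1 by (intro powr_mono2) (auto simp: M_def)
    moreover have "M powr (p - 1) = (p + 1) * (lam / 2 + 1)"
      using p_gt_1 lam_nonneg by (simp add: M_def powr_powr k_def)
    moreover have "z r powr (p + 1) = (z r)\<^sup>2 * z r powr (p - 1)"
    proof -
      have "z r powr (2 + (p - 1)) = (z r)\<^sup>2 * z r powr (p - 1)"
        unfolding powr_add using zz by simp
      then show ?thesis by (simp add: add.commute)
    qed
    ultimately have "(z r)\<^sup>2 * ((p + 1) * (lam / 2 + 1)) \<le> z r powr (p + 1)"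
      by (simp add: mult_left_mono)
    then have zE: "(z r)\<^sup>2 * (lam / 2 + 1) \<le> z r powr (p + 1) / (p + 1)"
      using p_gt_1 by (simp add: field_simps)
    have "(z r)\<^sup>2 \<le> E r" proof -
      have "0 \<le> (r * z' r)\<^sup>2 / 2" by simp
      with zE show ?thesis
        unfolding E_def distrib_left by (simp only: mult.commute[of lam] times_divide_eq_right mult_1_right)
    qed
    with E_le[OF that] have "(z r)\<^sup>2 \<le> \<bar>E R\<bar>" using E_le[OF that] by linarith
    moreover have "z r * 1 \<le> z r * z r" using zr zz by (intro mult_left_mono) auto
    ultimately show False using zr by (simp add: power2_eq_square)
  qed
  define Z where "Z = max M (1 + \<bar>E R\<bar>)"
  have Zp: "Z > 0" by (simp add: Z_def)
  define D where "D = sqrt (2 * \<bar>E R\<bar> + lam * Z\<^sup>2)"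
  have D: "\<bar>r * z' r\<bar> \<le> D" if "r \<ge> R" for r
  proof -
    have zz: "z r > 0" using zpos[of r] that R by simp
    have "(z r)\<^sup>2 \<le> Z\<^sup>2" using M[OF that] zz by (auto simp: Z_def intro!: power_mono)
    then have "lam * (z r)\<^sup>2 \<le> lam * Z\<^sup>2" using lam_nonneg by (rule mult_left_mono)
    moreover have "0 \<le> z r powr (p + 1) / (p + 1)" using p_gt_1 by simp
    ultimately have "(r * z' r)\<^sup>2 \<le> 2 * \<bar>E R\<bar> + lam * Z\<^sup>2"
      using E_le[OF that] abs_ge_self[of "E R"] unfolding E_def[of r] by linarith
    then show ?thesis unfolding D_def by (metis real_sqrt_abs real_sqrt_le_iff)
  qed
  \<comment> \<open>In \<open>2 * z'' / r\<close> the drift term \<open>- (r / 2) * z'\<close>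
    contributes \<open>- z'\<close>, which cancels the derivative of \<open>z\<close>. Only terms of
    order \<open>r powr (-3)\<close> survive.\<close>
  define y where "y r = z r + 2 * z' r / r" for r
  define y' where "y' r = (- 2 * (m + 1) * (r * z' r) + 2 * (lam * z r - z r powr p)) / r^3" for r
  have dy: "(y has_real_derivative y' r) (at r)" if r: "r > 0" for r
    unfolding y_def[abs_def] y'_def
    by (rule DERIV_cong[OF DERIV_add[OF dz[OF r] DERIV_divide[OF DERIV_cmult[OF dz'[OF r], of 2] DERIV_ident]]])
      (use r in \<open>simp_all add: field_simps power2_eq_square power3_eq_cube\<close>)
  define C where "C = 2 * \<bar>m + 1\<bar> * D + 2 * (lam * Z + Z powr p)"
  have C: "\<bar>y' r\<bar> \<le> C / r^3" if "r \<ge> R" for r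
  proof -
    have r: "r > 0" using that R by simp
    have "\<bar>- 2 * (m + 1) * (r * z' r)\<bar> \<le> 2 * \<bar>m + 1\<bar> * D"
      unfolding abs_mult using D[OF that] by (auto simp: abs_mult intro!: mult_mono)
    moreover have "\<bar>lam * z r - z r powr p\<bar> \<le> lam * Z + Z powr p"
    proof -
      have "lam * z r \<le> lam * Z" using M[OF that] lam_nonneg by (intro mult_left_mono) (auto simp: Z_def)
      moreover have "z r powr p \<le> Z powr p" using M[OF that] zpos[OF r] p_gt_1
        by (intro powr_mono2) (auto simp: Z_def)
      moreover have "0 \<le> lam * z r" using lam_nonneg zpos[OF r] by simp
      ultimately show ?thesis using powr_ge_zero[of "z r" p] by linarith
    qed
    moreover have "\<bar>a + 2 * b\<bar> \<le> A + 2 * B" if "\<bar>a\<bar> \<le> A" "\<bar>b\<bar> \<le> B" for a b A B :: real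
      using that by linarith
    ultimately have "\<bar>- 2 * (m + 1) * (r * z' r) + 2 * (lam * z r - z r powr p)\<bar> \<le> C"
      unfolding C_def by blast
    then show ?thesis unfolding y'_def abs_divide using r by (simp add: divide_right_mono)
  qed
  have C0: "C \<ge> 0" using lam_nonneg Zp by (auto simp: C_def D_def)
  have z'r: "\<bar>2 * z' r / r\<bar> \<le> 2 * D / r\<^sup>2" if "r \<ge> R" for r
    using D[OF that] R that by (simp add: abs_mult field_simps power2_eq_square)
  \<comment> \<open>The added term has derivative \<open>- C / r^3\<close>, so it makes the sum
    nonincreasing without changing the limit.\<close>
  obtain l where l: "((\<lambda>r. y r + C / (2 * r\<^sup>2)) \<longlongrightarrow> l) at_top"
  proof (rule antimono_bounded_below_tendsto[of R "\<lambda>r. y r + C / (2 * r\<^sup>2)" "- 2 * D"])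
    fix a b assume ab: "R \<le> a" "a \<le> b"
    show "y b + C / (2 * b\<^sup>2) \<le> y a + C / (2 * a\<^sup>2)"
    proof (rule DERIV_nonpos_imp_nonincreasing[OF ab(2)])
      fix x assume x: "a \<le> x" "x \<le> b"
      have x0: "x > 0" "x \<ge> R" using x ab R by auto
      have "((\<lambda>r. y r + C / (2 * r\<^sup>2)) has_real_derivative (y' x - C / x^3)) (at x)"
        apply (rule derivative_eq_intros dy[OF x0(1)] refl | use x0 in \<open>simp; fail\<close>)+
        using x0 by (simp add: field_simps power2_eq_square power3_eq_cube)
      then show "\<exists>y0. ((\<lambda>r. y r + C / (2 * r\<^sup>2)) has_real_derivative y0) (at x) \<and> y0 \<le> 0"
        using C[OF x0(2)] by (intro exI conjI) auto
    qed
  next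
    fix x assume x: "R \<le> x"
    have D0: "D \<ge> 0" using D[OF order_refl] by linarith
    have "x\<^sup>2 \<ge> 1" using x R by simp
    then have "2 * D / x\<^sup>2 \<le> 2 * D / 1" using D0 by (intro divide_left_mono) auto
    moreover have "0 \<le> C / (2 * x\<^sup>2)" using C0 by simp
    moreover have "z x > 0" using zpos[of x] x R by auto
    ultimately show "- 2 * D \<le> y x + C / (2 * x\<^sup>2)"
      using z'r[OF x] unfolding y_def by linarith
  qed
  have inv2: "((\<lambda>r. c / r\<^sup>2) \<longlongrightarrow> 0) at_top" for c :: real
    by (intro tendsto_divide_0[OF tendsto_const] filterlim_at_top_imp_at_infinity filterlim_pow_at_top filterlim_ident) simp
  have "((\<lambda>r. 2 * z' r / r) \<longlongrightarrow> 0) at_top"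
    by (rule Lim_null_comparison[OF _ inv2[of "2 * D"]])
       (rule eventually_at_top_linorderI[of R], simp only: real_norm_def z'r)
  then have "((\<lambda>r. (y r + C / (2 * r\<^sup>2)) - C / 2 / r\<^sup>2 - 2 * z' r / r) \<longlongrightarrow> l - 0 - 0) at_top"
    by (intro tendsto_diff l inv2)
  moreover have "(\<lambda>r. (y r + C / (2 * r\<^sup>2)) - C / 2 / r\<^sup>2 - 2 * z' r / r) = z"
    by (auto simp: y_def field_simps)
  ultimately have "(z \<longlongrightarrow> l) at_top" by simp
  moreover have "0 \<le> l"
    by (rule tendsto_lowerbound[OF calculation])
       (auto intro!: eventually_at_top_linorderI[of 1] less_imp_le zpos)
  ultimately show thesis using that[of l] by (simp add: decays_to_def two_k_eq z_def[abs_def])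
qed

section \<open>The monotone integral operator\<close>

lemma G_mono: "0 \<le> x \<Longrightarrow> x \<le> y \<Longrightarrow> G x \<le> G y"
  unfolding G_def using k_pos p_gt_1 by (intro add_mono mult_left_mono powr_mono2) auto

lemma G_nonneg: "0 \<le> x \<Longrightarrow> 0 \<le> G x"
  unfolding G_def using k_pos by simp

definition rho :: "real \<Rightarrow> real" where "rho r = r ^ (N - 1) * exp (r\<^sup>2 / 4)"

lemma rho_pos: "r > 0 \<Longrightarrow> rho r > 0" by (simp add: rho_def)
lemma rho_0 [simp]: "rho 0 = 0" using N_ge_3 by (simp add: rho_def)
lemma rho_nonneg: "r \<ge> 0 \<Longrightarrow> rho r \<ge> 0" by (simp add: rho_def)
lemma continuous_on_rho: "continuous_on A rho" unfolding rho_def by (intro continuous_intros) auto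
lemma rho_mono: "0 \<le> x \<Longrightarrow> x \<le> y \<Longrightarrow> rho x \<le> rho y"
  unfolding rho_def by (intro mult_mono power_mono) (auto intro!: power_mono)

lemma DERIV_rho:
  assumes "r > 0" shows "(rho has_real_derivative (rho r * ((real N - 1) / r + r / 2))) (at r)"
proof -
  obtain n where "N = Suc (Suc (Suc n))" using N_ge_3 by (metis numeral_3_eq_3 le_Suc_ex add_Suc)
  then have n: "N - 1 = Suc (Suc n)" "real N - 1 = Suc (Suc n)" by auto
  show ?thesis unfolding rho_def[abs_def] n using assms
    by (auto intro!: derivative_eq_intros simp: field_simps) (cases n; simp)
qed

lemma DERIV_rho_mult:
  assumes "r > 0" "(f has_real_derivative f') (at r)"
  shows "((\<lambda>r. rho r * f r) has_real_derivative (rho r * (f' + ((real N - 1) / r + r / 2) * f r))) (at r)"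
  using DERIV_mult[OF DERIV_rho[OF assms(1)] assms(2)] by (simp add: algebra_simps)

text \<open>\<open>L u = u'' + ((N - 1) / r + r / 2) u'\<close> equals \<open>(rho u')' / rho\<close>, so \<open>T f\<close> is the decaying
  solution of \<open>L u + G f = 0\<close> with \<open>u'(0) = 0\<close>. Working in \<open>ennreal\<close> postpones all questions of
  integrability.\<close>

definition J :: "(real \<Rightarrow> real) \<Rightarrow> real \<Rightarrow> ennreal" where
  "J f s = (\<integral>\<^sup>+x\<in>{0<..<s}. ennreal (rho x * G (f x)) \<partial>lborel)"

definition T :: "(real \<Rightarrow> real) \<Rightarrow> real \<Rightarrow> ennreal" where
  "T f r = (\<integral>\<^sup>+s\<in>{r<..}. (ennreal (1 / rho s) * J f s) \<partial>lborel)"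

lemma J_mono:
  assumes "\<And>x. x > 0 \<Longrightarrow> 0 \<le> f x \<and> f x \<le> g x" shows "J f s \<le> J g s"
  unfolding J_def
proof (rule nn_integral_mono)
  fix x
  have "rho x * G (f x) \<le> rho x * G (g x)" if "x > 0"
    using assms[OF that] that by (intro mult_left_mono G_mono rho_nonneg) auto
  then show "ennreal (rho x * G (f x)) * indicator {0<..<s} x \<le> ennreal (rho x * G (g x)) * indicator {0<..<s} x"
    by (cases "x \<in> {0<..<s}") (simp_all add: ennreal_leI)
qed

lemma T_mono:
  assumes "\<And>x. x > 0 \<Longrightarrow> 0 \<le> f x \<and> f x \<le> g x" shows "T f r \<le> T g r"
  unfolding T_def by (intro nn_integral_mono mult_right_mono mult_left_mono J_mono assms) simp_all

lemma T_antimono: "r \<le> s \<Longrightarrow> T f s \<le> T f r"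
  unfolding T_def by (rule nn_integral_set_mono) simp

text \<open>Integrating \<open>rho * G v <= - (rho * v')'\<close> from near \<open>0\<close> gives
  \<open>J v s <= - rho s * v' s\<close>; dividing by \<open>rho\<close> and integrating to infinity
  gives the claim. The boundary terms at both ends have a favourable sign, by \<open>v' <= 0\<close>
  and \<open>0 <= v\<close>, so no behaviour at \<open>0\<close> or at infinity is
  prescribed.\<close>

lemma T_supersolution_le:
  assumes dv: "\<And>r. r > 0 \<Longrightarrow> (v has_real_derivative v' r) (at r)"
    and dv': "\<And>r. r > 0 \<Longrightarrow> (v' has_real_derivative v'' r) (at r)"
    and v_nonneg: "\<And>r. r > 0 \<Longrightarrow> 0 \<le> v r" and v'_nonpos: "\<And>r. r > 0 \<Longrightarrow> v' r \<le> 0"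
    and super: "\<And>r. r > 0 \<Longrightarrow> v'' r + ((real N - 1) / r + r / 2) * v' r + G (v r) \<le> 0"
    and r: "r > 0"
  shows "T v r \<le> ennreal (v r)"
proof -
  have cv: "continuous_on A v" if "A \<subseteq> {0<..}" for A
    using dv that by (meson DERIV_isCont continuous_at_imp_continuous_on greaterThan_iff subsetD)
  have cv': "continuous_on A v'" if "A \<subseteq> {0<..}" for A
    using dv' that by (meson DERIV_isCont continuous_at_imp_continuous_on greaterThan_iff subsetD)
  have J: "J v s \<le> ennreal (- rho s * v' s)" if s: "s > 0" for s
  proof -
    have "{0<..<s} \<subseteq> (\<Union>n. {1 / real (Suc n)..s})"
    proof
      fix x assume "x \<in> {0<..<s}"
      then obtain n where "inverse (real (Suc n)) < x" using reals_Archimedean[of x] by auto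
      with \<open>x \<in> _\<close> show "x \<in> (\<Union>n. {1 / real (Suc n)..s})"
        by (auto simp: inverse_eq_divide intro!: exI[of _ n])
    qed
    then have "J v s \<le> (\<integral>\<^sup>+x\<in>(\<Union>n. {1 / real (Suc n)..s}). ennreal (rho x * G (v x)) \<partial>lborel)"
      unfolding J_def by (rule nn_integral_set_mono)
    also have "\<dots> \<le> ennreal (- rho s * v' s)"
    proof (rule nn_integral_UN_le)
      show "incseq (\<lambda>n. {1 / real (Suc n)..s})"
        by (intro incseq_SucI) (simp add: frac_le)
    next
      fix n
      let ?a = "1 / real (Suc n)"
      have a: "?a > 0" by simp
      show "(\<lambda>x. ennreal (rho x * G (v x)) * indicator {?a..s} x) \<in> borel_measurable lborel"
      proof -
        have pos: "x > 0" if "x \<in> {?a..s}" for x using that a by (meson atLeastAtMost_iff order.strict_trans2)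
        then have "{?a..s} \<subseteq> {0<..}" by blast
        moreover have "\<forall>x\<in>{?a..s}. 0 \<le> v x \<and> (v x = 0 \<longrightarrow> 0 < p)"
          using v_nonneg pos p_gt_1 by fastforce
        ultimately show ?thesis
          unfolding G_def by (intro borel_measurable_ennreal_indicator_continuous_on continuous_on_mult
            continuous_on_add continuous_on_const continuous_on_rho cv continuous_on_powr')
      qed
      show "(\<integral>\<^sup>+x\<in>{?a..s}. ennreal (rho x * G (v x)) \<partial>lborel) \<le> ennreal (- rho s * v' s)"
      proof (cases "?a \<le> s")
        case True
        let ?P' = "\<lambda>x. - (rho x * (v'' x + ((real N - 1) / x + x / 2) * v' x))"
        have le: "rho x * G (v x) \<le> ?P' x" if "x > 0" for x
          using mult_left_mono[OF super[OF that], of "rho x"] rho_pos[OF that]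
          by (simp add: algebra_simps)
        have "(\<integral>\<^sup>+x\<in>{?a..s}. ennreal (rho x * G (v x)) \<partial>lborel) \<le> (\<integral>\<^sup>+x\<in>{?a..s}. ennreal (?P' x) \<partial>lborel)"
          using a by (intro nn_integral_mono) (auto simp: indicator_def  intro!: ennreal_leI le order.strict_trans2[OF a])
        also have "\<dots> = ennreal (- (rho s * v' s) - - (rho ?a * v' ?a))"
        proof (rule nn_integral_has_real_derivative_nonneg(1)[OF True])
          fix x assume x: "?a \<le> x" "x \<le> s"
          then have "x > 0" using a by linarith
          then show "((\<lambda>x. - (rho x * v' x)) has_real_derivative ?P' x) (at x)"
            by (intro DERIV_minus DERIV_rho_mult dv')
          show "0 \<le> ?P' x"
            using le[OF \<open>x > 0\<close>] G_nonneg[OF v_nonneg[OF \<open>x > 0\<close>]] rho_pos[OF \<open>x > 0\<close>]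
            by (meson mult_nonneg_nonneg less_imp_le order_trans)
        qed
        also have "\<dots> \<le> ennreal (- rho s * v' s)"
          using mult_nonneg_nonpos[OF less_imp_le[OF rho_pos[OF a]] v'_nonpos[OF a]]
          by (intro ennreal_leI) simp
        finally show ?thesis .
      qed auto
    qed
    finally show ?thesis .
  qed
  have "{r<..} \<subseteq> (\<Union>n. {r..r + real n})"
  proof
    fix x assume "x \<in> {r<..}"
    moreover obtain n where "x - r \<le> real n" using real_arch_simple by blast
    ultimately show "x \<in> (\<Union>n. {r..r + real n})" by (auto intro!: exI[of _ n])
  qed
  then have "T v r \<le> (\<integral>\<^sup>+s\<in>(\<Union>n. {r..r + real n}). ennreal (- v' s) \<partial>lborel)"
    unfolding T_def
  proof (intro nn_integral_mono)
    fix s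
    assume sub: "{r<..} \<subseteq> (\<Union>n. {r..r + real n})"
    show "ennreal (1 / rho s) * J v s * indicator {r<..} s \<le> ennreal (- v' s) * indicator (\<Union>n. {r..r + real n}) s"
    proof (cases "s \<in> {r<..}")
      case True
      then have s: "s > 0" using r by simp
      have "ennreal (1 / rho s) * J v s \<le> ennreal (1 / rho s) * ennreal (- rho s * v' s)"
        by (intro mult_left_mono J s) auto
      also have "\<dots> = ennreal (- v' s)"
        using rho_pos[OF s] v'_nonpos[OF s] by (subst ennreal_mult[symmetric]) (auto simp: mult_nonneg_nonpos)
      finally show ?thesis using True sub by (auto simp: indicator_def)
    qed auto
  qed
  also have "\<dots> \<le> ennreal (v r)"
  proof (rule nn_integral_UN_le)
    fix n
    show "(\<lambda>x. ennreal (- v' x) * indicator {r..r + real n} x) \<in> borel_measurable lborel"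
      using r by (intro borel_measurable_ennreal_indicator_continuous_on continuous_intros cv') auto
    have "(\<integral>\<^sup>+x\<in>{r..r + real n}. ennreal (- v' x) \<partial>lborel) = ennreal (- v (r + real n) - - v r)"
      using r by (intro nn_integral_has_real_derivative_nonneg(1)) (auto intro!: DERIV_minus dv v'_nonpos)
    also have "\<dots> \<le> ennreal (v r)" using v_nonneg[of "r + real n"] r by (intro ennreal_leI) auto
    finally show "(\<integral>\<^sup>+x\<in>{r..r + real n}. ennreal (- v' x) \<partial>lborel) \<le> ennreal (v r)" .
  next
    show "incseq (\<lambda>n. {r..r + real n})" by (rule incseq_SucI) simp
  qed
  finally show ?thesis .
qed

text \<open>Cutting \<open>T\<close> off at \<open>v\<close> gives a monotone map of a complete
  lattice. Its greatest fixed point lies above \<open>w\<close>, because \<open>w\<close> is a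
  post-fixed point, and the cut-off is inactive there because
  \<open>T g <= T v <= v\<close>.\<close>

lemma T_fixed_point:
  assumes wv: "\<And>r. r > 0 \<Longrightarrow> 0 \<le> w r \<and> w r \<le> v r"
    and Tv: "\<And>r. r > 0 \<Longrightarrow> T v r \<le> ennreal (v r)"
    and Tw: "\<And>r. r > 0 \<Longrightarrow> ennreal (w r) \<le> T w r"
  obtains g where "\<And>r. r > 0 \<Longrightarrow> w r \<le> g r \<and> g r \<le> v r" "\<And>r. r > 0 \<Longrightarrow> ennreal (g r) = T g r"
proof -
  \<comment> \<open>The minimum with \<open>v\<close> is finite, so \<open>enn2real\<close> loses
    nothing and stays monotone.\<close>
  define c where "c f x = enn2real (inf (f x) (ennreal (v x)))" for f :: "real \<Rightarrow> ennreal" and x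
  define F where "F f r = inf (ennreal (v r)) (T (c f) r)" for f r
  have c_mono: "c f x \<le> c g x" if "f \<le> g" for f g x
    unfolding c_def using that by (intro enn2real_mono inf_mono) (auto simp: le_fun_def less_top[symmetric])
  have c0: "0 \<le> c f x" for f x by (simp add: c_def)
  have F_mono: "mono F"
    unfolding F_def by (intro monoI le_funI inf_mono T_mono conjI c_mono c0) (auto dest: le_funD)
  define f where "f = gfp F"
  have fF: "f = F f" unfolding f_def by (rule gfp_unfold[OF F_mono])
  have fv: "f r \<le> ennreal (v r)" for r by (subst fF) (simp add: F_def)
  define g where "g = c f"
  have fg: "f r = ennreal (g r)" for r
    using fv[of r] unfolding g_def c_def by (simp add: inf_absorb1 le_less_trans[OF fv])
  have gv: "0 \<le> g r \<and> g r \<le> v r" if "r > 0" for r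
  proof -
    have "0 \<le> g r" by (simp add: g_def c0)
    then show ?thesis using fv[of r] wv[OF that] by (simp add: fg)
  qed
  have gT: "ennreal (g r) = T g r" if "r > 0" for r
  proof -
    have "T g r \<le> T v r" by (intro T_mono gv)
    also have "\<dots> \<le> ennreal (v r)" by (rule Tv[OF that])
    finally have "F f r = T g r" by (simp add: F_def g_def inf_absorb2)
    then show ?thesis using fF fg by metis
  qed
  \<comment> \<open>Nothing is assumed about \<open>w\<close> and \<open>v\<close> off the positive
    axis, so the least value is used there.\<close>
  define w0 where "w0 r = (if r > 0 then ennreal (w r) else 0)" for r
  have "w0 \<le> F w0"
  proof (rule le_funI)
    fix r
    have "w0 r \<le> F w0 r" if "r > 0"
    proof -
      have "0 \<le> w x \<and> w x \<le> c w0 x" if "x > 0" for x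
      proof -
        have "inf (w0 x) (ennreal (v x)) = ennreal (w x)"
          using wv[OF that] that by (simp add: w0_def inf_absorb1 ennreal_leI)
        then show ?thesis using wv[OF that] by (simp add: c_def)
      qed
      then have "T w r \<le> T (c w0) r" by (intro T_mono)
      then show ?thesis using that wv[OF that] Tw[OF that] by (auto simp: F_def w0_def ennreal_leI)
    qed
    then show "w0 r \<le> F w0 r" by (cases "r > 0") (auto simp: w0_def)
  qed
  then have "w0 \<le> f" unfolding f_def by (rule gfp_upperbound)
  then have "w r \<le> g r" if "r > 0" for r
    using that gv[OF that] le_funD[OF \<open>w0 \<le> f\<close>, of r] by (simp add: w0_def fg)
  with gv gT that show thesis by blast
qed

text \<open>Regularity is bootstrapped: \<open>T g\<close> is nonincreasing, so \<open>g\<close> is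
  Borel on the positive axis; boundedness makes the flux \<open>H\<close> finite and continuous;
  hence \<open>u\<close> is continuously differentiable, the integrand of \<open>H\<close> is
  continuous on the positive axis, and \<open>H\<close> is differentiable.\<close>

lemma solution_of_T_fixed_point:
  assumes g_pos: "\<And>r. r > 0 \<Longrightarrow> 0 < g r" and g_le: "\<And>r. r > 0 \<Longrightarrow> g r \<le> B"
    and gT: "\<And>r. r > 0 \<Longrightarrow> ennreal (g r) = T g r"
  obtains u u' where "\<And>r. r > 0 \<Longrightarrow> u r = g r" "positive_solution N p u" "u 0 > 0"
    "C1_deriv_on u u' {0..}" "u' 0 = 0"
proof -
  have B: "B > 0" using g_pos[of 1] g_le[of 1] by linarith
  have g_anti: "g s \<le> g r" if "0 < r" "r \<le> s" for r s
  proof -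
    have "ennreal (g s) \<le> ennreal (g r)" using that gT[of r] gT[of s] T_antimono[OF that(2)] by simp
    then show ?thesis using g_pos[OF that(1)] by simp
  qed
  \<comment> \<open>The value \<open>B\<close> keeps the extension nonincreasing on the whole line,
    hence measurable, with the same bounds.\<close>
  define gt where "gt r = (if r > 0 then g r else B)" for r
  have "mono (\<lambda>r. - gt r)" using g_anti g_le by (intro monoI) (auto simp: gt_def)
  then have "(\<lambda>r. - (- gt r)) \<in> borel_measurable borel" by (intro borel_measurable_uminus borel_measurable_mono)
  then have gt_meas [measurable]: "gt \<in> borel_measurable borel" by simp
  have gt: "0 < gt r" "gt r \<le> B" for r using g_pos g_le B by (auto simp: gt_def)
  define h where "h x = rho x * G (gt x)" for x
  have [measurable]: "rho \<in> borel_measurable borel"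
    by (intro borel_measurable_continuous_onI continuous_on_rho)
  have h_meas: "h \<in> borel_measurable borel" unfolding h_def[abs_def] G_def by measurable
  have h_nonneg: "0 \<le> h x" if "x \<ge> 0" for x
    unfolding h_def using gt[of x] that by (intro mult_nonneg_nonneg rho_nonneg G_nonneg) auto
  have h_le: "h x \<le> rho s * G B" if "0 \<le> x" "x \<le> s" for x s
    unfolding h_def using gt[of x] that by (intro mult_mono rho_mono rho_nonneg G_mono G_nonneg) auto
  have h_int: "h integrable_on {0..s}" for s
  proof (rule set_borel_integral_eq_integral(1))
    have "set_integrable lborel {0..s} (\<lambda>_. rho s * G B)" by (rule borel_integrable_atLeastAtMost') simp
    then show "set_integrable lborel {0..s} h"
    proof (rule set_integrable_bound)
      show "set_borel_measurable lborel {0..s} h" unfolding set_borel_measurable_def using h_meas by measurable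
      show "AE x in lborel. x \<in> {0..s} \<longrightarrow> norm (h x) \<le> norm (rho s * G B)"
        using h_nonneg h_le by (intro AE_I2) (force)
    qed
  qed
  define H where "H s = integral {0..s} h" for s
  have H: "(h has_integral H s) {0..s}" for s unfolding H_def using h_int by blast
  have H_nonneg: "0 \<le> H s" for s
    unfolding H_def by (rule integral_nonneg[OF h_int]) (auto intro: h_nonneg)
  have J_eq: "J g s = ennreal (H s)" for s
  proof -
    have "J g s = (\<integral>\<^sup>+x\<in>{0<..<s}. ennreal (h x) \<partial>lborel)"
      unfolding J_def by (intro nn_integral_cong) (auto simp: h_def gt_def split: split_indicator)
    also have "\<dots> = ennreal (H s)"
      using H[of s] h_nonneg by (intro nn_integral_has_integral_lebesgue') (auto simp: has_integral_Icc_iff_Ioo[symmetric])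
    finally show ?thesis .
  qed
  have H_mono: "mono H"
    using h_int h_nonneg unfolding H_def by (intro monoI integral_subset_le) auto
  have H_cont: "continuous_on {0..b} H" for b
    unfolding H_def[abs_def] by (rule indefinite_integral_continuous_1[OF h_int])
  have H_le: "H s \<le> rho s * G B * s" if "s \<ge> 0" for s
    using has_integral_le[OF H[of s] has_integral_const_real[of "rho s * G B" 0 s]] h_le that by (simp add: mult.commute)
  \<comment> \<open>This is \<open>- u'\<close>. Division by \<open>rho 0 = 0\<close> yields
    \<open>q 0 = 0\<close>, which is also the limit at \<open>0\<close>, since \<open>rho\<close> is
    nondecreasing and so \<open>q s <= G B * s\<close>.\<close>
  define q where "q s = H s / rho s" for s
  have q_nonneg: "0 \<le> q s" if "s \<ge> 0" for s unfolding q_def using H_nonneg rho_nonneg[OF that] by simp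
  have q0: "q 0 = 0" by (simp add: q_def)
  have q_le: "q s \<le> G B * s" if "s \<ge> 0" for s
  proof (cases "s = 0")
    case False
    then have "rho s > 0" using that by (intro rho_pos) auto
    then show ?thesis using H_le[OF that] by (simp add: q_def field_simps)
  qed (simp add: q0)
  have q_cont: "continuous_on {0..b} q" for b
  proof (clarsimp simp: continuous_on_eq_continuous_within)
    fix x assume x: "0 \<le> x" "x \<le> b"
    show "continuous (at x within {0..b}) q"
    proof (cases "x = 0")
      case False
      then have "rho x \<noteq> 0" using rho_pos[of x] x by auto
      then show ?thesis unfolding q_def[abs_def] using x H_cont[of b] continuous_on_rho[of "{0..b}"]
        unfolding continuous_within by (intro tendsto_divide) (auto simp: continuous_on_def)
    next
      case True
      have "((\<lambda>s. G B * s) \<longlongrightarrow> 0) (at 0 within {0..b})" by (auto intro!: tendsto_eq_intros)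
      then have "(q \<longlongrightarrow> 0) (at 0 within {0..b})"
        by (rule Lim_null_comparison[rotated])
           (auto simp: eventually_at_filter q_le q_nonneg intro!: always_eventually)
      then show ?thesis using True by (simp add: continuous_within q0)
    qed
  qed
  have q_int: "q integrable_on {a..b}" if "0 \<le> a" for a b
    by (rule integrable_continuous_real, rule continuous_on_subset[OF q_cont[of b]]) (use that in auto)
  \<comment> \<open>Splitting the half-line at \<open>R\<close> turns the improper integral into a
    proper one with finite remainder \<open>g R\<close>.\<close>
  have g_diff: "g r = integral {r..R} q + g R" if r: "0 < r" "r \<le> R" for r R
  proof -
    have [measurable]: "H \<in> borel_measurable borel" by (rule borel_measurable_mono[OF H_mono])
    let ?f = "\<lambda>s. ennreal (1 / rho s) * J g s"
    have "{r<..} = {r<..R} \<union> {R<..}" using r by auto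
    then have "T g r = (\<integral>\<^sup>+s\<in>{r<..R} \<union> {R<..}. ?f s \<partial>lborel)" by (simp add: T_def)
    also have "\<dots> = (\<integral>\<^sup>+s\<in>{r<..R}. ?f s \<partial>lborel) + T g R"
      unfolding T_def J_eq by (intro nn_integral_disjoint_pair) auto
    also have "(\<integral>\<^sup>+s\<in>{r<..R}. ?f s \<partial>lborel) = (\<integral>\<^sup>+s\<in>{r<..R}. ennreal (q s) \<partial>lborel)"
      using r by (intro nn_integral_cong)
        (auto simp: q_def J_eq H_nonneg rho_nonneg ennreal_mult[symmetric] split: split_indicator)
    also have "\<dots> = ennreal (integral {r..R} q)"
    proof (rule nn_integral_has_integral_lebesgue')
      have "(q has_integral integral {r..R} q) {r..R}" using q_int[of r R] r by (simp add: integrable_integral)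
      then show "(q has_integral integral {r..R} q) {r<..R}"
        by (subst (asm) has_integral_spike_set_eq[where T = "{r<..R}"]) (auto intro: negligible_subset[OF negligible_sing[of r]])
    qed (use r in \<open>auto intro: q_nonneg\<close>)
    finally have "ennreal (g r) = ennreal (integral {r..R} q) + ennreal (g R)"
      using gT[of r] gT[of R] r by simp
    moreover have "0 \<le> integral {r..R} q"
      using r q_int[of r R] by (intro integral_nonneg) (auto intro: q_nonneg)
    ultimately show ?thesis using g_pos[of r] g_pos[of R] r
      by (simp add: ennreal_plus[symmetric] del: ennreal_plus)
  qed
  \<comment> \<open>Anchored at \<open>1\<close>, the formula also supplies the value at
    \<open>0\<close>, where \<open>g\<close> is unconstrained.\<close>
  define u where "u r = g 1 + integral {0..1} q - integral {0..r} q" for r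
  have comb: "integral {0..a} q + integral {a..b} q = integral {0..b} q" if "0 \<le> a" "a \<le> b" for a b
    using that q_int[of 0 b] by (intro Henstock_Kurzweil_Integration.integral_combine) auto
  have ug: "u r = g r" if "r > 0" for r
    using g_diff[of r 1] g_diff[of 1 r] comb[of r 1] comb[of 1 r] that
    unfolding u_def by (cases "r \<le> 1") auto
  have du0: "(u has_real_derivative - q r) (at r within {0..})" if r: "r \<ge> 0" for r
  proof -
    have "((\<lambda>x. integral {0..x} q) has_real_derivative q r) (at r within {0..r+1})"
      using r by (intro integral_has_real_derivative q_cont) auto
    moreover have "at r within {0..r+1} = at r within {0..}"
      by (rule at_within_nhd[of r "{..<r+1}"]) auto
    ultimately show ?thesis unfolding u_def[abs_def] by (auto intro!: derivative_eq_intros)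
  qed
  have at: "at r within {0..} = at r" if "r > 0" for r :: real
    using that by (intro at_within_interior) auto
  have du: "(u has_real_derivative - q r) (at r)" if "r > 0" for r
    using du0[of r] that by (simp add: at)
  have u_cont: "continuous_on A u" if "A \<subseteq> {0<..}" for A
    using du that by (meson DERIV_isCont continuous_at_imp_continuous_on greaterThan_iff subsetD)
  have Gu_cont: "continuous_on A (\<lambda>x. G (u x))" if "A \<subseteq> {0<..}" for A
  proof -
    have "\<forall>x\<in>A. 0 \<le> u x \<and> (u x = 0 \<longrightarrow> 0 < p)"
      using that p_gt_1 g_pos ug by (metis greaterThan_iff less_imp_le less_numeral_extra(3) subsetD)
    then show ?thesis unfolding G_def
      by (intro continuous_on_add continuous_on_mult continuous_on_const u_cont continuous_on_powr' that)
  qed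
  have dH: "(H has_real_derivative h r) (at r)" if r: "r > 0" for r
  proof -
    \<comment> \<open>The interval stays away from \<open>0\<close>, because \<open>gt\<close> need
      not agree with \<open>u\<close> there.\<close>
    have "continuous_on {r/2..r+1} (\<lambda>x. rho x * G (u x))"
      using r by (intro continuous_on_mult continuous_on_rho Gu_cont) auto
    then have h_cont: "continuous_on {r/2..r+1} h"
      by (rule continuous_on_eq) (use r in \<open>auto simp: h_def gt_def ug\<close>)
    have "((\<lambda>x. H (r/2) + integral {r/2..x} h) has_real_derivative h r) (at r within {r/2..r+1})"
      using r integral_has_real_derivative[OF h_cont, of r] by (auto intro!: derivative_eq_intros)
    then have "(H has_real_derivative h r) (at r within {r/2..r+1})"
    proof (rule has_field_derivative_transform_within[where d = 1])
      fix x assume "x \<in> {r/2..r+1}"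
      then show "H (r/2) + integral {r/2..x} h = H x"
        unfolding H_def using r h_int by (subst Henstock_Kurzweil_Integration.integral_combine) auto
    qed (use r in auto)
    then show ?thesis using r by (subst (asm) at_within_interior) auto
  qed
  have dq: "(q has_real_derivative (G (u r) - ((real N - 1) / r + r / 2) * q r)) (at r)" if r: "r > 0" for r
  proof -
    have nz: "rho r \<noteq> 0" using rho_pos[OF r] by simp
    show ?thesis unfolding q_def[abs_def]
      by (rule DERIV_cong[OF DERIV_divide[OF dH[OF r] DERIV_rho[OF r] nz]])
         (use nz r in \<open>simp add: h_def gt_def ug diff_divide_distrib\<close>)
  qed
  have qc: "continuous_on {0<..} q"
    using dq by (meson DERIV_isCont continuous_at_imp_continuous_on greaterThan_iff)
  have qc0: "continuous_on {0..} q"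
  proof (clarsimp simp: continuous_on_eq_continuous_within)
    fix x :: real assume x: "0 \<le> x"
    have "at x within {0..x+1} = at x within {0..}"
      by (rule at_within_nhd[of x "{..<x+1}"]) auto
    moreover have "(q \<longlongrightarrow> q x) (at x within {0..x+1})"
      using q_cont[of "x+1"] x by (auto simp: continuous_on_def)
    ultimately show "continuous (at x within {0..}) q" by (simp add: continuous_within)
  qed
  have at': "at r within {0<..} = at r" if "r > 0" for r :: real
    using that by (intro at_within_open) auto
  have "positive_solution N p u"
    unfolding positive_solution_def
  proof (intro conjI exI)
    show "\<forall>r>0. u r > 0" using ug g_pos by simp
    show "C1_deriv_on u (\<lambda>r. - q r) {0<..}"
      using du at' qc by (auto simp: C1_deriv_on_def intro: continuous_intros)
    show "C1_deriv_on (\<lambda>r. - q r) (\<lambda>r. - (G (u r) - ((real N - 1) / r + r / 2) * q r)) {0<..}"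
      unfolding C1_deriv_on_def
    proof (intro conjI ballI)
      fix r :: real assume "r \<in> {0<..}"
      then show "((\<lambda>r. - q r) has_real_derivative - (G (u r) - ((real N - 1) / r + r / 2) * q r)) (at r within {0<..})"
        using DERIV_minus[OF dq[of r]] at'[of r] by simp
    qed (auto intro!: continuous_intros Gu_cont qc)
    show "\<forall>r>0. - (G (u r) - ((real N - 1) / r + r / 2) * q r) + ((real N - 1) / r + r / 2) * - q r
        + 1 / (p - 1) * u r + u r powr p = 0"
      by (simp add: G_def k_def)
  qed
  moreover have "u 0 > 0"
  proof -
    have "0 \<le> integral {0..1} q" using q_int[of 0 1] by (intro integral_nonneg) (auto intro: q_nonneg)
    then show ?thesis using g_pos[of 1] by (simp add: u_def)
  qed
  moreover have "C1_deriv_on u (\<lambda>r. - q r) {0..}"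
    using du0 qc0 by (auto simp: C1_deriv_on_def intro: continuous_intros)
  ultimately show thesis using that[of u "\<lambda>r. - q r"] ug q0 by simp
qed

section \<open>Lower bounds for the supremum from bounded supersolutions\<close>

definition supersolution :: "(real \<Rightarrow> real) \<Rightarrow> bool" where
  "supersolution v \<longleftrightarrow> (\<exists>v' v''. \<forall>r>0. 0 < v r \<and> v' r \<le> 0 \<and>
     (v has_real_derivative v' r) (at r) \<and> (v' has_real_derivative v'' r) (at r) \<and>
     v'' r + ((real N - 1) / r + r / 2) * v' r + G (v r) \<le> 0)"

text \<open>The truncation \<open>r1\<close> is the critical point of
  \<open>l r powr (- 2 k) (1 - a / r\<^sup>2)\<close>; replacing this function by its value at \<open>r1\<close> on \<open>[0, r1]\<close> gives a
  bounded subsolution, already of the linear equation \<open>L u + k u = 0\<close>.\<close>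

lemma exists_subsolution:
  assumes l: "l > 0"
  obtains w r1 where "r1 \<ge> R" "r1 > 0" "\<And>r. 0 < w r" "\<And>r. r \<le> r1 \<Longrightarrow> w r = w r1"
    "\<And>r. r \<ge> r1 \<Longrightarrow> w r \<le> l * r powr (- 2 * k)"
    "((\<lambda>r. r powr (2 * k) * w r) \<longlongrightarrow> l) at_top" "\<And>r. r > 0 \<Longrightarrow> ennreal (w r) \<le> T w r"
proof -
  \<comment> \<open>Up to the factor \<open>t r / r\<^sup>2\<close>, the linear expression in
    \<open>sub\<close> is \<open>a\<close> minus terms whose sum is at most \<open>M\<close> for
    \<open>r >= r1\<close>; hence \<open>a >= M\<close> suffices.\<close>
  define M where "M = 2 * k * (real N - 2 * k - 2) + 2 * k * \<bar>2 * k + 4 - real N\<bar>"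
  define r1 where "r1 = max R (1 + (k + 1) / k * \<bar>M\<bar>)"
  have r1: "r1 \<ge> R" "r1 \<ge> 1" using k_pos by (simp_all add: r1_def le_max_iff_disj)
  \<comment> \<open>This choice is equivalent to \<open>phi' r1 = 0\<close>. It also gives
    \<open>a / r\<^sup>2 <= k / (k + 1) < 1\<close> beyond \<open>r1\<close>, hence
    \<open>phi > 0\<close> and \<open>phi' <= 0\<close>, and \<open>a >= M\<close> once
    \<open>r1\<close> is large.\<close>
  define a where "a = k * r1\<^sup>2 / (k + 1)"
  have a_pos: "a > 0" using k_pos r1 by (simp add: a_def)
  have a_ge: "a \<ge> M"
  proof -
    have "(k + 1) / k * \<bar>M\<bar> \<le> r1" by (simp add: r1_def)
    also have "r1 \<le> r1\<^sup>2" using r1(2) mult_left_mono[OF r1(2), of r1] by (simp add: power2_eq_square)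
    finally have "\<bar>M\<bar> \<le> a" using k_pos by (simp add: a_def field_simps)
    then show ?thesis by linarith
  qed
  have a_r1: "a * (k + 1) = k * r1\<^sup>2" using k_pos by (simp add: a_def)
  define t where "t r = l * r powr (- 2 * k)" for r :: real
  define phi where "phi r = t r * (1 - a / r\<^sup>2)" for r
  define phi' where "phi' r = t r * (- 2 * k / r + a * (2 * k + 2) / r^3)" for r
  define phi'' where "phi'' r = t r * (2 * k * (2 * k + 1) / r\<^sup>2 - a * (2 * k + 2) * (2 * k + 3) / r^4)" for r
  have t_pos: "t r > 0" if "r > 0" for r using l that by (simp add: t_def)
  have dt: "(t has_real_derivative (t r * (- 2 * k / r))) (at r)" if "r > 0" for r
    unfolding t_def[abs_def] using DERIV_cmult[OF DERIV_powr_const[OF DERIV_ident that, of "- 2 * k"], of l]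
    by (simp add: mult_ac)
  have dphi: "(phi has_real_derivative phi' r) (at r)" if "r > 0" for r
  proof -
    have "((\<lambda>r. 1 - a / r\<^sup>2) has_real_derivative (2 * a / r^3)) (at r)"
      using that by (auto intro!: derivative_eq_intros simp: field_simps power2_eq_square power3_eq_cube)
    from DERIV_mult[OF dt[OF that] this] show ?thesis
      unfolding phi_def[abs_def] phi'_def
      by (rule DERIV_cong) (use that in \<open>simp add: field_simps power2_eq_square power3_eq_cube\<close>)
  qed
  have dphi': "(phi' has_real_derivative phi'' r) (at r)" if "r > 0" for r
  proof -
    have "((\<lambda>r. - 2 * k / r + a * (2 * k + 2) / r^3) has_real_derivative (2 * k / r\<^sup>2 - 3 * a * (2 * k + 2) / r^4)) (at r)"
      using that by (auto intro!: derivative_eq_intros simp: field_simps power2_eq_square power3_eq_cube power4_eq_xxxx)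
    from DERIV_mult[OF dt[OF that] this] show ?thesis
      unfolding phi'_def[abs_def] phi''_def
      by (rule DERIV_cong) (use that in \<open>simp add: field_simps power2_eq_square power3_eq_cube power4_eq_xxxx\<close>)
  qed
  have sub: "phi'' r + ((real N - 1) / r + r / 2) * phi' r + k * phi r \<ge> 0" if "r \<ge> r1" for r
  proof -
    have r: "r > 0" using that r1 by linarith
    have "phi'' r + ((real N - 1) / r + r / 2) * phi' r + k * phi r
      = t r / r\<^sup>2 * (a - 2 * k * (real N - 2 * k - 2) - a * (2 * k + 2) * (2 * k + 4 - real N) / r\<^sup>2)"
      unfolding phi_def phi'_def phi''_def using r
      by (simp add: field_simps power2_eq_square power3_eq_cube power4_eq_xxxx)
    moreover have "a * (2 * k + 2) * (2 * k + 4 - real N) / r\<^sup>2 \<le> 2 * k * \<bar>2 * k + 4 - real N\<bar>"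
    proof -
      have "a * (2 * k + 2) = 2 * k * r1\<^sup>2" using a_r1 by (simp add: algebra_simps)
      moreover have "r1\<^sup>2 \<le> r\<^sup>2" using that r1 by (intro power_mono) auto
      ultimately have "a * (2 * k + 2) \<le> 2 * k * r\<^sup>2" using k_pos by simp
      then have "a * (2 * k + 2) * (2 * k + 4 - real N) \<le> 2 * k * r\<^sup>2 * \<bar>2 * k + 4 - real N\<bar>"
        using a_pos k_pos by (intro order_trans[OF mult_left_mono[OF abs_ge_self] mult_right_mono]) auto
      then show ?thesis using r by (simp add: field_simps)
    qed
    ultimately show ?thesis using a_ge t_pos[OF r] unfolding M_def by simp
  qed
  have a_le: "a / r\<^sup>2 \<le> k / (k + 1)" if "r \<ge> r1" for r
  proof -
    have "r1\<^sup>2 \<le> r\<^sup>2" "r > 0" using that r1 by (auto intro!: power_mono)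
    then have "a / r\<^sup>2 \<le> a / r1\<^sup>2" using a_pos r1 by (intro divide_left_mono) auto
    then show ?thesis using r1 by (simp add: a_def)
  qed
  have phi_pos: "phi r > 0" if "r \<ge> r1" for r
  proof -
    have "k / (k + 1) < 1" using k_pos by simp
    then show ?thesis unfolding phi_def using a_le[OF that] t_pos[of r] that r1 by (intro mult_pos_pos) linarith+
  qed
  have phi'_nonpos: "phi' r \<le> 0" if "r \<ge> r1" for r
  proof -
    have r: "r > 0" using that r1 by linarith
    have "a * (2 * k + 2) / r^3 = 2 * (k + 1) / r * (a / r\<^sup>2)"
      using r by (simp add: field_simps power2_eq_square power3_eq_cube)
    also have "\<dots> \<le> 2 * (k + 1) / r * (k / (k + 1))"
      using a_le[OF that] r k_pos by (intro mult_left_mono) auto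
    also have "\<dots> = 2 * k / r" using k_pos r by (simp add: divide_simps; simp add: algebra_simps)
    finally show ?thesis unfolding phi'_def using t_pos[OF r] by (intro mult_nonneg_nonpos) auto
  qed
  have phi'_r1: "phi' r1 = 0"
  proof -
    have "a * (2 * k + 2) = 2 * k * r1\<^sup>2" using a_r1 by (simp add: algebra_simps)
    then show ?thesis unfolding phi'_def using r1 by (simp add: power2_eq_square power3_eq_cube)
  qed
  define w where "w r = phi (max r r1)" for r
  have w_pos: "0 < w r" for r unfolding w_def by (rule phi_pos) simp
  have w_eq: "w r = phi r" if "r \<ge> r1" for r using that by (simp add: w_def max_absorb1)
  \<comment> \<open>The part of \<open>J\<close> over \<open>(0, r1]\<close> and the power term of
    \<open>G\<close> are nonnegative and dropped; \<open>phi' r1 = 0\<close> leaves no boundary term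
    at the junction.\<close>
  have J_ge: "ennreal (- (rho s * phi' s)) \<le> J w s" if s: "s \<ge> r1" for s
  proof -
    have pos: "x > 0" if "x \<ge> r1" for x using that r1 by linarith
    have "ennreal (- (rho s * phi' s)) = ennreal (- (rho s * phi' s) - - (rho r1 * phi' r1))" by (simp add: phi'_r1)
    also have "\<dots> \<le> (\<integral>\<^sup>+x\<in>{r1<..<s}. ennreal (rho x * (k * phi x)) \<partial>lborel)"
    proof (rule nn_integral_ge_derivative[OF s])
      fix x assume x: "r1 \<le> x"
      show "((\<lambda>x. - (rho x * phi' x)) has_real_derivative
          - (rho x * (phi'' x + ((real N - 1) / x + x / 2) * phi' x))) (at x)"
        by (intro DERIV_minus DERIV_rho_mult dphi' pos x)
      have "rho x * - (phi'' x + ((real N - 1) / x + x / 2) * phi' x) \<le> rho x * (k * phi x)"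
        using sub[OF x] rho_nonneg[of x] pos[OF x] by (intro mult_left_mono) auto
      then show "- (rho x * (phi'' x + ((real N - 1) / x + x / 2) * phi' x)) \<le> rho x * (k * phi x)"
        by (simp only: mult_minus_right)
      show "0 \<le> rho x * (k * phi x)"
        using phi_pos[OF x] k_pos rho_nonneg[of x] pos[OF x] by simp
    next
      have "continuous_on {r1..s} phi"
        by (intro continuous_at_imp_continuous_on ballI DERIV_isCont[OF dphi] pos) simp
      then show "continuous_on {r1..s} (\<lambda>x. rho x * (k * phi x))"
        by (intro continuous_on_mult continuous_on_rho continuous_on_const)
    qed
    also have "\<dots> \<le> J w s"
      unfolding J_def
    proof (rule nn_integral_mono)
      fix x
      have "rho x * (k * phi x) \<le> rho x * G (w x)" if "r1 < x"
        unfolding G_def using that w_eq[of x] rho_nonneg[of x] pos[of x] by (intro mult_left_mono) auto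
      then show "ennreal (rho x * (k * phi x)) * indicator {r1<..<s} x \<le> ennreal (rho x * G (w x)) * indicator {0<..<s} x"
        using r1 by (cases "x \<in> {r1<..<s}") (simp_all add: ennreal_leI)
    qed
    finally show ?thesis .
  qed
  have phi_lim: "((\<lambda>r. r powr (2 * k) * phi r) \<longlongrightarrow> l) at_top"
  proof -
    have "((\<lambda>r. l * (1 - a / r\<^sup>2)) \<longlongrightarrow> l * (1 - 0)) at_top"
      by (intro tendsto_intros tendsto_divide_0[OF tendsto_const] filterlim_at_top_imp_at_infinity filterlim_pow_at_top filterlim_ident) simp
    moreover have "eventually (\<lambda>r. l * (1 - a / r\<^sup>2) = r powr (2 * k) * phi r) at_top"
      using eventually_gt_at_top[of 0]
      by eventually_elim (simp add: phi_def t_def powr_minus)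
    ultimately show ?thesis by (simp add: tendsto_cong)
  qed
  have phi_0: "(phi \<longlongrightarrow> 0) at_top"
  proof -
    have "((\<lambda>r. r powr (- 2 * k) * (r powr (2 * k) * phi r)) \<longlongrightarrow> 0 * l) at_top"
      using k_pos by (intro tendsto_mult phi_lim tendsto_neg_powr filterlim_ident) simp
    moreover have "eventually (\<lambda>r. r powr (- 2 * k) * (r powr (2 * k) * phi r) = phi r) at_top"
      using eventually_gt_at_top[of 0] by eventually_elim (simp add: powr_minus)
    ultimately show ?thesis unfolding mult_zero_left by (rule Lim_transform_eventually)
  qed
  have T_ge: "ennreal (phi r) \<le> T w r" if r: "r \<ge> r1" for r
  proof -
    have le: "ennreal (phi r - phi R') \<le> T w r" if R': "R' \<ge> r" for R'
    proof -
      have pos: "x > 0" if "x \<ge> r" for x using that r r1 by linarith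
      have "ennreal (phi r - phi R') = ennreal (- phi R' - - phi r)" by simp
      also have "\<dots> = (\<integral>\<^sup>+x\<in>{r<..<R'}. ennreal (- phi' x) \<partial>lborel)"
        using r by (intro nn_integral_has_real_derivative_nonneg(2)[symmetric, OF R'])
          (auto intro!: DERIV_minus dphi pos phi'_nonpos)
      also have "\<dots> \<le> T w r"
        unfolding T_def
      proof (rule nn_integral_mono)
        fix x
        show "ennreal (- phi' x) * indicator {r<..<R'} x \<le> ennreal (1 / rho x) * J w x * indicator {r<..} x"
        proof (cases "x \<in> {r<..<R'}")
          case True
          then have x: "x > 0" "x \<ge> r1" using pos[of x] r by auto
          have "ennreal (- phi' x) = ennreal (1 / rho x * - (rho x * phi' x))"
            using rho_pos[OF x(1)] by simp
          also have "\<dots> = ennreal (1 / rho x) * ennreal (- (rho x * phi' x))"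
            using rho_pos[OF x(1)] by (intro ennreal_mult'') (simp add: phi'_nonpos[OF x(2)] mult_nonneg_nonpos)
          also have "\<dots> \<le> ennreal (1 / rho x) * J w x"
            by (intro mult_left_mono J_ge x) simp
          finally show ?thesis using True by simp
        qed simp
      qed
      finally show ?thesis .
    qed
    show ?thesis
    proof (rule tendsto_upperbound)
      show "((\<lambda>R'. ennreal (phi r - phi R')) \<longlongrightarrow> ennreal (phi r)) at_top"
        using tendsto_ennrealI[OF tendsto_diff[OF tendsto_const phi_0]] by simp
      show "eventually (\<lambda>R'. ennreal (phi r - phi R') \<le> T w r) at_top"
        by (rule eventually_at_top_linorderI[of r]) (rule le)
    qed simp
  qed
  show thesis
  proof (rule that[of r1 w])
    show "ennreal (w r) \<le> T w r" for r
    proof (cases "r \<ge> r1")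
      case False
      then have "ennreal (w r) = ennreal (phi r1)" by (simp add: w_def)
      also have "\<dots> \<le> T w r1" by (rule T_ge) simp
      also have "\<dots> \<le> T w r" using False by (intro T_antimono) simp
      finally show ?thesis .
    qed (simp add: w_eq T_ge)
    show "w r \<le> l * r powr (- 2 * k)" if "r \<ge> r1" for r
    proof -
      have "t r * (1 - a / r\<^sup>2) \<le> t r * 1" using that r1 a_pos t_pos[of r] by (intro mult_left_mono) auto
      then show ?thesis using that by (simp add: w_eq phi_def t_def)
    qed
    have "eventually (\<lambda>r. r powr (2 * k) * phi r = r powr (2 * k) * w r) at_top"
      using eventually_ge_at_top[of r1] by eventually_elim (simp add: w_eq)
    then show "((\<lambda>r. r powr (2 * k) * w r) \<longlongrightarrow> l) at_top" by (rule Lim_transform_eventually[OF phi_lim])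
  qed (use r1 w_pos in \<open>auto simp: w_def\<close>)
qed

text \<open>A comparison near infinity is enough: \<open>r1\<close> can be chosen beyond its
  threshold, and inside \<open>r1\<close> the subsolution is constant while \<open>v\<close>
  decreases outwards. The limit \<open>L\<close> of the solution in between need not be
  \<open>l\<close>; \<open>L >= l\<close> suffices for a supremum.\<close>

lemma le_ell_star_of_supersolution:
  assumes super: "supersolution v" and bd: "\<And>r. r > 0 \<Longrightarrow> v r \<le> B" and l: "l > 0"
    and ev: "eventually (\<lambda>r. l * r powr (- 2 * k) \<le> v r) at_top"
  shows "ereal l \<le> ell_star N p"
proof -
  from super obtain v' v'' where v: "\<And>r. r > 0 \<Longrightarrow> 0 < v r" "\<And>r. r > 0 \<Longrightarrow> v' r \<le> 0"
    "\<And>r. r > 0 \<Longrightarrow> (v has_real_derivative v' r) (at r)" "\<And>r. r > 0 \<Longrightarrow> (v' has_real_derivative v'' r) (at r)"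
    "\<And>r. r > 0 \<Longrightarrow> v'' r + ((real N - 1) / r + r / 2) * v' r + G (v r) \<le> 0"
    unfolding supersolution_def by metis
  have v_anti: "v s \<le> v r" if "0 < r" "r \<le> s" for r s
  proof (rule DERIV_nonpos_imp_nonincreasing[OF that(2)])
    fix x assume "r \<le> x"
    then have "x > 0" using that by linarith
    then show "\<exists>y. (v has_real_derivative y) (at x) \<and> y \<le> 0" using v(2,3) by blast
  qed
  from ev obtain R where R: "\<And>r. r \<ge> R \<Longrightarrow> l * r powr (- 2 * k) \<le> v r"
    by (auto simp: eventually_at_top_linorder)
  obtain w r1 where w: "r1 \<ge> R" "r1 > 0" "\<And>r. 0 < w r" "\<And>r. r \<le> r1 \<Longrightarrow> w r = w r1"
    "\<And>r. r \<ge> r1 \<Longrightarrow> w r \<le> l * r powr (- 2 * k)"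
    "((\<lambda>r. r powr (2 * k) * w r) \<longlongrightarrow> l) at_top" "\<And>r. r > 0 \<Longrightarrow> ennreal (w r) \<le> T w r"
    by (rule exists_subsolution[OF l, of R]) (rule that; assumption)
  have wv_far: "w r \<le> v r" if "r \<ge> r1" for r
    using w(5)[OF that] R[of r] that w(1) by simp
  have wv: "w r \<le> v r" if "r > 0" for r
  proof (cases "r \<ge> r1")
    case False
    then show ?thesis using w(4)[of r] wv_far[of r1] v_anti[OF that, of r1] by simp
  qed (rule wv_far)
  have Tv: "T v r \<le> ennreal (v r)" if "r > 0" for r
    by (rule T_supersolution_le[OF v(3) v(4) _ v(2) v(5) that]) (auto intro: less_imp_le v(1))
  have w0v: "0 \<le> w r \<and> w r \<le> v r" if "r > 0" for r using wv[OF that] w(3)[of r] by simp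
  obtain g where g: "\<And>r. r > 0 \<Longrightarrow> w r \<le> g r \<and> g r \<le> v r" "\<And>r. r > 0 \<Longrightarrow> ennreal (g r) = T g r"
    by (rule T_fixed_point[OF w0v Tv w(7)]) (assumption | rule that; assumption)+
  have g_bd: "0 < g r" "g r \<le> B" if "r > 0" for r
    using g(1)[OF that] w(3)[of r] bd[OF that] by linarith+
  obtain u u' where u: "\<And>r. r > 0 \<Longrightarrow> u r = g r" "positive_solution N p u" "u 0 > 0"
    "C1_deriv_on u u' {0..}" "u' 0 = 0"
    by (rule solution_of_T_fixed_point[OF g_bd g(2)]) (assumption | rule that; assumption)+
  obtain L where L: "decays_to p u L" by (rule positive_solution_decays_to[OF u(2)]) (rule that; assumption)
  have "l \<le> L"
  proof (rule tendsto_le[OF _ _ w(6)])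
    show "((\<lambda>r. r powr (2 * k) * u r) \<longlongrightarrow> L) at_top" using L by (simp add: decays_to_def two_k_eq)
    show "eventually (\<lambda>r. r powr (2 * k) * w r \<le> r powr (2 * k) * u r) at_top"
      using eventually_gt_at_top[of 0] by eventually_elim (simp add: u(1) g(1) mult_left_mono)
  qed simp
  moreover have "u \<in> S_set N p L" using u L by (auto simp: S_set_def)
  ultimately have "ereal L \<le> ell_star N p"
    unfolding ell_star_def using l by (intro Sup_upper) auto
  then show ?thesis using \<open>l \<le> L\<close> by (meson ereal_less_eq(3) order_trans)
qed

section \<open>The supremum is not over the empty set\<close>

lemma powr_p_eq:
  assumes "x > 0" shows "x powr p = x * x powr (1 / k)"
proof -
  have "x powr p = x powr (1 + 1 / k)" by (rule arg_cong[OF p_eq])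
  then show ?thesis using assms by (simp add: powr_add)
qed

lemma powr_p_of_powr_minus_k:
  assumes "x > 0" shows "(x powr (- k)) powr p = x powr (- k) / x"
proof -
  have "- k * p = - k - 1" using k_mult_p by simp
  then show ?thesis using assms by (simp add: powr_powr powr_diff)
qed

text \<open>With \<open>Y = 1 + r\<^sup>2 / 2\<close>, the linear operator \<open>L + k\<close> maps \<open>Y powr (-k) + 2 k Y powr (-k - 1)\<close> below
  \<open>- k / (k + 2) Y powr (-k - 1)\<close>, which absorbs the nonlinearity after multiplication by a small
  constant.\<close>

lemma ell_star_nonneg: "0 \<le> ell_star N p"
proof -
  \<comment> \<open>Solves \<open>(e * (1 + 2 * k)) powr p = e * k / (k + 2)\<close>, so the
    nonlinearity exactly fits into the linear gain.\<close>
  define e where "e = (k / (k + 2) / (1 + 2 * k) powr p) powr k"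
  have e_pos: "e > 0" using k_pos by (simp add: e_def)
  have e_powr: "e powr p * (1 + 2 * k) powr p = e * (k / (k + 2))"
  proof -
    have "e powr p = e * e powr (1 / k)" using e_pos by (rule powr_p_eq)
    also have "e powr (1 / k) = k / (k + 2) / (1 + 2 * k) powr p"
      using k_pos by (simp add: e_def powr_powr)
    finally show ?thesis using k_pos by simp
  qed
  define Y where "Y r = 1 + r\<^sup>2 / 2" for r :: real
  define t where "t r = e * Y r powr (- k)" for r
  \<comment> \<open>With \<open>N\<close> replaced by \<open>2 * k + 2\<close>,
    \<open>Y powr (-k)\<close> alone leaves \<open>+ k * Y powr (-k - 1)\<close> to leading order. A
    correction \<open>c * Y powr (-k - 1)\<close> contributes \<open>- c * Y powr (-k - 1)\<close>,
    and \<open>c = 2 * k\<close> reverses the sign.\<close>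
  define v where "v r = t r * (1 + 2 * k / Y r)" for r
  define A where "A r = - k / Y r - 2 * k * (k + 1) / (Y r)\<^sup>2" for r
  define B where "B r = k * (k + 1) / (Y r)\<^sup>2 + 2 * k * (k + 1) * (k + 2) / (Y r)^3" for r
  have Y_ge: "Y r \<ge> 1" for r by (simp add: Y_def)
  have Y_pos: "Y r > 0" for r using Y_ge[of r] by linarith
  have dY: "(Y has_real_derivative r) (at r)" for r
    unfolding Y_def[abs_def] by (auto intro!: derivative_eq_intros)
  have t_pos: "t r > 0" for r using e_pos Y_pos[of r] by (simp add: t_def)
  have dt: "(t has_real_derivative (- k * t r * (r / Y r))) (at r)" for r
    unfolding t_def[abs_def]
    by (rule DERIV_cong[OF DERIV_cmult[OF DERIV_powr_const[OF dY Y_pos]]]) simp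
  have diY: "((\<lambda>r. c / Y r) has_real_derivative (- c * r / (Y r)\<^sup>2)) (at r)"
    "((\<lambda>r. c / (Y r)\<^sup>2) has_real_derivative (- 2 * c * r / (Y r)^3)) (at r)" for c r
    using Y_pos[of r]
    by (auto intro!: derivative_eq_intros dY simp: field_simps power2_eq_square power3_eq_cube)
  have dv: "(v has_real_derivative (r * (t r * A r))) (at r)" for r
  proof -
    have "((\<lambda>r. 1 + 2 * k / Y r) has_real_derivative (- 2 * k * r / (Y r)\<^sup>2)) (at r)"
      using DERIV_add[OF DERIV_const diY(1)[of "2 * k" r]] by simp
    from DERIV_mult[OF dt this] show ?thesis unfolding v_def[abs_def] A_def
      by (rule DERIV_cong) (use Y_pos[of r] in \<open>simp add: field_simps power2_eq_square\<close>)
  qed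
  have dA: "((\<lambda>r. t r * A r) has_real_derivative (r * (t r * B r))) (at r)" for r
  proof -
    have "(A has_real_derivative (k * r / (Y r)\<^sup>2 + 4 * k * (k + 1) * r / (Y r)^3)) (at r)"
      unfolding A_def[abs_def]
      by (rule DERIV_cong[OF DERIV_diff[OF diY]]) (use Y_pos[of r] in \<open>simp add: field_simps\<close>)
    from DERIV_mult[OF dt this] show ?thesis unfolding A_def B_def
      by (rule DERIV_cong) (use Y_pos[of r] in \<open>simp add: field_simps power2_eq_square power3_eq_cube\<close>)
  qed
  have dv': "((\<lambda>r. r * (t r * A r)) has_real_derivative (t r * (A r + r\<^sup>2 * B r))) (at r)" for r
    by (rule DERIV_cong[OF DERIV_mult[OF DERIV_ident dA]]) (simp add: algebra_simps power2_eq_square)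
  have A_neg: "A r \<le> 0" for r
  proof -
    have "0 \<le> k / Y r" "0 \<le> 2 * k * (k + 1) / (Y r)\<^sup>2" using k_pos Y_pos[of r] by simp_all
    then show ?thesis unfolding A_def by linarith
  qed
  have v_pos: "v r > 0" for r
    unfolding v_def using t_pos[of r] k_pos Y_pos[of r] by (simp add: add_pos_nonneg)
  have v_le: "v r \<le> t r * (1 + 2 * k)" for r
  proof -
    have "2 * k / Y r \<le> 2 * k / 1" using k_pos Y_ge[of r] by (intro divide_left_mono) auto
    then show ?thesis unfolding v_def using t_pos[of r] by (intro mult_left_mono) auto
  qed
  have "t r \<le> e" for r
  proof -
    have "Y r powr (- k) \<le> 1 powr (- k)" using k_pos Y_ge[of r] by (intro powr_mono2') auto
    then show ?thesis using e_pos by (simp add: t_def)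
  qed
  then have v_bd: "v r \<le> e * (1 + 2 * k)" for r
    using v_le[of r] k_pos by (meson add_nonneg_nonneg less_imp_le mult_right_mono order_trans zero_le_mult_iff zero_le_numeral zero_le_one)
  have super: "t r * (A r + r\<^sup>2 * B r) + ((real N - 1) / r + r / 2) * (r * (t r * A r)) + G (v r) \<le> 0"
    if r: "r > 0" for r
  proof -
    define y where "y = 1 / Y r"
    have Yy: "Y r * y = 1" using Y_pos[of r] by (simp add: y_def)
    have r2: "r\<^sup>2 = 2 * Y r - 2" by (simp add: Y_def)
    have y_pos: "y > 0" using Y_pos[of r] by (simp add: y_def)
    have A_y: "A r = - k * y - 2 * k * (k + 1) * y\<^sup>2"
      and B_y: "B r = k * (k + 1) * y\<^sup>2 + 2 * k * (k + 1) * (k + 2) * y^3"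
      and v_y: "v r = t r * (1 + 2 * k * y)"
      by (simp_all add: A_def B_def v_def y_def power_divide)
    have "((real N - 1) / r + r / 2) * r = real N - 1 + (Y r - 1)"
      using r by (simp add: Y_def field_simps power2_eq_square)
    then have "((real N - 1) / r + r / 2) * (r * (t r * A r)) = t r * ((real N - 1 + (Y r - 1)) * A r)"
      by (metis mult.assoc mult.left_commute)
    \<comment> \<open>As \<open>A r <= 0\<close>, the smallest admissible dimension is the worst
      case.\<close>
    moreover have "real N * A r \<le> (2 * k + 2) * A r" using k_le A_neg by (rule mult_right_mono_neg)
    then have "t r * ((real N - 1 + (Y r - 1)) * A r) \<le> t r * ((2 * k + Y r) * A r)"
      using t_pos[of r] by (intro mult_left_mono) (simp_all add: algebra_simps)
    ultimately have "t r * (A r + r\<^sup>2 * B r) + ((real N - 1) / r + r / 2) * (r * (t r * A r)) + k * v r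
      \<le> t r * (A r + r\<^sup>2 * B r + (2 * k + Y r) * A r + k * (1 + 2 * k * y))"
      unfolding v_y by (simp add: algebra_simps)
    also have "A r + r\<^sup>2 * B r + (2 * k + Y r) * A r + k * (1 + 2 * k * y)
      = - k * y * (1 - 4 * (k + 1) * y + 4 * (k + 1) * (k + 2) * y\<^sup>2)"
      unfolding A_y B_y r2 using Yy by algebra
    \<comment> \<open>Completing the square in \<open>y\<close> isolates the gain
      \<open>1 / (k + 2)\<close>.\<close>
    also have "\<dots> = - k * y * (1 / (k + 2) + (k + 1) / (k + 2) * (1 - 2 * (k + 2) * y)\<^sup>2)"
      using k_pos by (simp add: divide_simps) (simp add: algebra_simps power2_eq_square)
    also have "\<dots> \<le> - k * y * (1 / (k + 2))"
      using k_pos y_pos by (intro mult_left_mono_neg) auto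
    finally have lin: "t r * (A r + r\<^sup>2 * B r) + ((real N - 1) / r + r / 2) * (r * (t r * A r)) + k * v r
      \<le> t r * (- k * y * (1 / (k + 2)))"
      using t_pos[of r] by simp
    have "v r powr p \<le> (t r * (1 + 2 * k)) powr p"
      using v_pos[of r] v_le[of r] p_gt_1 by (intro powr_mono2) auto
    also have "\<dots> = (e powr p * (1 + 2 * k) powr p) * (Y r powr (- k) / Y r)"
      using e_pos k_pos powr_p_of_powr_minus_k[OF Y_pos, of r] by (simp add: t_def powr_mult)
    also have "\<dots> = t r * (k * y * (1 / (k + 2)))"
      unfolding e_powr by (simp add: t_def y_def mult_ac)
    finally show ?thesis using lin unfolding G_def by simp
  qed
  have "supersolution v"
    unfolding supersolution_def
  proof (intro exI allI impI conjI)
    show "r * (t r * A r) \<le> 0" if "r > 0" for r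
      using that t_pos[of r] A_neg[of r] by (intro mult_nonneg_nonpos) auto
  qed (rule v_pos dv dv' super; assumption?)+
  moreover have "eventually (\<lambda>r. e * r powr (- 2 * k) \<le> v r) at_top"
    using eventually_ge_at_top[of 2]
  proof eventually_elim
    fix r :: real assume r: "2 \<le> r"
    have "2 * 2 \<le> r * r" using r by (intro mult_mono) auto
    then have "Y r \<le> r\<^sup>2" unfolding Y_def power2_eq_square by simp
    then have "(r\<^sup>2) powr (- k) \<le> Y r powr (- k)" using k_pos Y_pos[of r] by (intro powr_mono2') auto
    moreover have "(r\<^sup>2) powr (- k) = r powr (- 2 * k)"
      using r by (simp add: powr_powr flip: powr_numeral)
    ultimately have "e * r powr (- 2 * k) \<le> t r" using e_pos by (simp add: t_def)
    also have "\<dots> \<le> v r" unfolding v_def using t_pos[of r] k_pos Y_pos[of r] by simp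
    finally show "e * r powr (- 2 * k) \<le> v r" .
  qed
  ultimately have "ereal e \<le> ell_star N p"
    by (intro le_ell_star_of_supersolution[of v "e * (1 + 2 * k)"] v_bd e_pos)
  moreover have "0 \<le> ereal e" using e_pos by simp
  ultimately show ?thesis by (rule order_trans[rotated])
qed

section \<open>Singular solutions and conclusion\<close>

text \<open>The flux \<open>rho * u'\<close> is nonincreasing. If it were positive at
  \<open>r\<close>, it would be positive on all of \<open>(0, r]\<close>, so \<open>u\<close> would
  be at most \<open>u r\<close> there, against the blow-up at \<open>0\<close>.\<close>

lemma singular_solution_antimono:
  assumes u_pos: "\<And>r. r > 0 \<Longrightarrow> u r > 0"
    and du: "\<And>r. r > 0 \<Longrightarrow> (u has_real_derivative u' r) (at r)"
    and du': "\<And>r. r > 0 \<Longrightarrow> (u' has_real_derivative u'' r) (at r)"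
    and ode: "\<And>r. r > 0 \<Longrightarrow> u'' r + ((real N - 1) / r + r / 2) * u' r + G (u r) = 0"
    and lim: "filterlim u at_top (at_right 0)" and r: "r > 0"
  shows "u' r \<le> 0"
proof (rule ccontr)
  assume neg: "\<not> u' r \<le> 0"
  have flux: "rho r * u' r \<le> rho s * u' s" if s: "0 < s" "s \<le> r" for s
  proof (rule DERIV_nonpos_imp_nonincreasing[OF s(2)])
    fix x assume "s \<le> x"
    then have x: "x > 0" using s by linarith
    have "u'' x + ((real N - 1) / x + x / 2) * u' x \<le> 0"
      using ode[OF x] G_nonneg[of "u x"] u_pos[OF x] by simp
    then have "rho x * (u'' x + ((real N - 1) / x + x / 2) * u' x) \<le> 0"
      using rho_pos[OF x] by (intro mult_nonneg_nonpos) auto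
    then show "\<exists>y. ((\<lambda>r. rho r * u' r) has_real_derivative y) (at x) \<and> y \<le> 0"
      using DERIV_rho_mult[OF x du'[OF x]] by blast
  qed
  have u'_pos: "u' s > 0" if "0 < s" "s \<le> r" for s
    using flux[OF that] neg rho_pos[OF r] rho_pos[OF that(1)]
    by (smt (verit) mult_pos_pos zero_less_mult_pos)
  have u_le: "u s \<le> u r" if s: "0 < s" "s \<le> r" for s
  proof (rule DERIV_nonneg_imp_nondecreasing[OF s(2)])
    fix x assume "s \<le> x" "x \<le> r"
    then show "\<exists>y. (u has_real_derivative y) (at x) \<and> 0 \<le> y"
      using du[of x] u'_pos[of x] s by (intro exI[of _ "u' x"]) auto
  qed
  have "eventually (\<lambda>s. u r < u s) (at_right 0)" using lim by (simp add: filterlim_at_top_dense)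
  moreover have "eventually (\<lambda>s. s \<in> {0<..<r}) (at_right 0)" by (rule eventually_at_right_real[OF r])
  ultimately have "eventually (\<lambda>s. False) (at_right (0::real))"
    by eventually_elim (use u_le in force)
  then show False by simp
qed

text \<open>In terms of \<open>w = u powr (-1/k)\<close> the equation reads
  \<open>L w = (k + 1) w'\<^sup>2 / w + w + 1 / k\<close>. For \<open>K > 1\<close> the affine change \<open>W = K w + (K - 1) / k\<close> turns it
  into the inequality \<open>L W \<ge> (k + 1) W'\<^sup>2 / W + W + 1 / k\<close>, so \<open>W powr (-k)\<close> is a supersolution, which is
  bounded although \<open>u\<close> is not.\<close>

lemma le_ell_star_of_singular_solution:
  assumes u: "positive_solution N p u" "filterlim u at_top (at_right 0)"
    and dec: "decays_to p u l" and l: "l > 0" and K: "K > 1" and l': "0 < l'" "l' < K powr (- k) * l"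
  shows "ereal l' \<le> ell_star N p"
proof -
  obtain u' u'' where u_pos: "\<And>r. r > 0 \<Longrightarrow> u r > 0"
    and du: "\<And>r. r > 0 \<Longrightarrow> (u has_real_derivative u' r) (at r)"
    and du': "\<And>r. r > 0 \<Longrightarrow> (u' has_real_derivative u'' r) (at r)"
    and ode: "\<And>r. r > 0 \<Longrightarrow> u'' r + ((real N - 1) / r + r / 2) * u' r + G (u r) = 0"
    by (rule positive_solutionE[OF u(1)]) (rule that; assumption)
  have u'_nonpos: "u' r \<le> 0" if "r > 0" for r
    by (rule singular_solution_antimono[OF u_pos du du' ode u(2) that])
  \<comment> \<open>Equivalent to \<open>W + 1 / k = K * (w + 1 / k)\<close>. Positivity of
    \<open>c\<close> keeps \<open>W\<close> away from \<open>0\<close> where \<open>u\<close> blows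
    up, hence \<open>v\<close> bounded.\<close>
  define c where "c = (K - 1) / k"
  have c_pos: "c > 0" using K k_pos by (simp add: c_def)
  define m where "m r = u' r / u r" for r
  define w where "w r = u r powr (- 1 / k)" for r
  define W where "W r = K * w r + c" for r
  define W' where "W' r = - (K / k) * (w r * m r)" for r
  define W'' where "W'' r = K / k * w r * ((1 / k + 1) * (m r)\<^sup>2 - u'' r / u r)" for r
  define v where "v r = W r powr (- k)" for r
  define v' where "v' r = - k * (v r * (W' r / W r))" for r
  define v'' where "v'' r = - k * (v r * (W'' r / W r - (k + 1) * (W' r / W r)\<^sup>2))" for r
  have w_pos: "w r > 0" if "r > 0" for r using u_pos[OF that] by (simp add: w_def)
  have W_gt: "W r > c" if "r > 0" for r using w_pos[OF that] K by (simp add: W_def)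
  have W_pos: "W r > 0" if "r > 0" for r using W_gt[OF that] c_pos by linarith
  have v_pos: "v r > 0" if "r > 0" for r using W_pos[OF that] by (simp add: v_def)
  have dw: "(w has_real_derivative (- (1 / k) * (w r * m r))) (at r)" if "r > 0" for r
    unfolding w_def[abs_def] m_def
    using DERIV_powr_const[OF du[OF that] u_pos[OF that], of "- 1 / k"] by simp
  have dm: "(m has_real_derivative (u'' r / u r - (m r)\<^sup>2)) (at r)" if "r > 0" for r
    unfolding m_def[abs_def]
    by (rule DERIV_cong[OF DERIV_divide[OF du'[OF that] du[OF that]]])
      (use u_pos[OF that] in \<open>simp_all add: field_simps power2_eq_square\<close>)
  have dW: "(W has_real_derivative W' r) (at r)" if "r > 0" for r
    unfolding W_def[abs_def] W'_def using DERIV_add[OF DERIV_cmult[OF dw[OF that], of K] DERIV_const[of c]]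
    by simp
  have dW': "(W' has_real_derivative W'' r) (at r)" if "r > 0" for r
    unfolding W'_def[abs_def] W''_def
    by (rule DERIV_cong[OF DERIV_cmult[OF DERIV_mult[OF dw[OF that] dm[OF that]]]])
      (simp add: algebra_simps power2_eq_square)
  have dv: "(v has_real_derivative v' r) (at r)" if "r > 0" for r
    unfolding v_def[abs_def] v'_def by (rule DERIV_powr_const[OF dW[OF that] W_pos[OF that]])
  have dv': "(v' has_real_derivative v'' r) (at r)" if "r > 0" for r
  proof -
    have "((\<lambda>r. W' r / W r) has_real_derivative (W'' r / W r - (W' r / W r)\<^sup>2)) (at r)"
      by (rule DERIV_cong[OF DERIV_divide[OF dW'[OF that] dW[OF that]]])
        (use W_pos[OF that] in \<open>simp_all add: field_simps power2_eq_square\<close>)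
    from DERIV_cmult[OF DERIV_mult[OF dv[OF that] this], of "- k"] show ?thesis
      unfolding v'_def[abs_def] v''_def
    proof (rule DERIV_cong)
      have "- k * (- k * (x * q) * q + (y - q\<^sup>2) * x) = - k * (x * (y - (k + 1) * q\<^sup>2))" for x y q :: real
        by algebra
      then show "- k * (- k * (v r * (W' r / W r)) * (W' r / W r) + (W'' r / W r - (W' r / W r)\<^sup>2) * v r) =
          - k * (v r * (W'' r / W r - (k + 1) * (W' r / W r)\<^sup>2))"
        .
    qed
  qed
  have v'_nonpos: "v' r \<le> 0" if "r > 0" for r
  proof -
    have "m r \<le> 0" using u'_nonpos[OF that] u_pos[OF that] by (simp add: m_def divide_nonpos_pos)
    then have "0 \<le> W' r" using w_pos[OF that] K k_pos unfolding W'_def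
      by (simp add: mult_nonneg_nonpos divide_nonpos_pos)
    then show ?thesis using v_pos[OF that] W_pos[OF that] k_pos by (simp add: v'_def)
  qed
  have super: "v'' r + ((real N - 1) / r + r / 2) * v' r + G (v r) \<le> 0" if r: "r > 0" for r
  proof -
    define a where "a = (real N - 1) / r + r / 2"
    have u_powr: "u r powr p = u r / w r"
      using u_pos[OF r] by (simp add: powr_p_eq w_def powr_minus_divide)
    have "u'' r / u r + a * m r = - (k + 1 / w r)"
    proof -
      have "u'' r + a * u' r = - (k * u r + u r / w r)" using ode[OF r] by (simp add: a_def G_def u_powr)
      then have "(u'' r + a * u' r) / u r = - (k * u r + u r / w r) / u r" by simp
      then show ?thesis using u_pos[OF r] by (simp add: m_def add_divide_distrib diff_divide_distrib)
    qed
    then have U: "u'' r / u r = - (k + 1 / w r) - a * m r" by linarith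
    have "x * y * (q * z\<^sup>2 - (- s - b * z)) + b * (- x * (y * z)) = x * y * q * z\<^sup>2 + x * y * s"
      for x y q z s b :: real by algebra
    from this[of "K / k" "w r" "1 / k + 1" "m r" "k + 1 / w r" a]
    have LW: "W'' r + a * W' r = K / k * w r * (1 / k + 1) * (m r)\<^sup>2 + K / k * w r * (k + 1 / w r)"
      unfolding W''_def W'_def U by simp
    have Kw: "K / k * w r * (k + 1 / w r) = K * w r + K / k"
      using w_pos[OF r] k_pos by (simp add: field_simps)
    have "(k + 1) * (W' r)\<^sup>2 / W r \<le> K / k * w r * (1 / k + 1) * (m r)\<^sup>2"
    proof -
      have "(k + 1) * (W' r)\<^sup>2 / W r = (K / k * w r * (1 / k + 1) * (m r)\<^sup>2) * (K * w r / W r)"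
        unfolding W'_def using W_pos[OF r] k_pos by (simp add: field_simps power2_eq_square)
      \<comment> \<open>The only inequality in the computation, from \<open>K * w r <= W r\<close>;
        it expresses the concavity of the map from \<open>u\<close> to \<open>v\<close>.\<close>
      also have "\<dots> \<le> (K / k * w r * (1 / k + 1) * (m r)\<^sup>2) * 1"
        using W_pos[OF r] k_pos w_pos[OF r] K c_pos by (intro mult_left_mono) (auto simp: W_def)
      finally show ?thesis by simp
    qed
    moreover have "K * w r + K / k = W r + 1 / k" by (simp add: W_def c_def diff_divide_distrib)
    ultimately have ineq: "(k + 1) * (W' r)\<^sup>2 / W r + W r + 1 / k \<le> W'' r + a * W' r"
      unfolding LW Kw by linarith
    have "v r powr p = v r / W r" unfolding v_def by (rule powr_p_of_powr_minus_k[OF W_pos[OF r]])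
    then have "v'' r + a * v' r + G (v r) =
      k * (v r / W r) * (((k + 1) * (W' r)\<^sup>2 / W r + W r + 1 / k) - (W'' r + a * W' r))"
      unfolding v''_def v'_def G_def using W_pos[OF r] k_pos by (simp add: field_simps power2_eq_square)
    also have "\<dots> \<le> 0"
      using ineq v_pos[OF r] W_pos[OF r] k_pos by (intro mult_nonneg_nonpos) auto
    finally show ?thesis by (simp add: a_def)
  qed
  have "supersolution v"
    unfolding supersolution_def using v_pos v'_nonpos dv dv' super by blast
  moreover have "v r \<le> c powr (- k)" if "r > 0" for r
    unfolding v_def using W_gt[OF that] c_pos k_pos by (intro powr_mono2') auto
  moreover have "eventually (\<lambda>r. l' * r powr (- 2 * k) \<le> v r) at_top"
  proof -
    have z: "((\<lambda>r. r powr (2 * k) * u r) \<longlongrightarrow> l) at_top" using dec by (simp add: decays_to_def two_k_eq)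
    \<comment> \<open>The function is \<open>r powr (2 * k) * v r\<close> for \<open>r > 0\<close>;
      the shift \<open>c\<close> vanishes after division by \<open>r\<^sup>2\<close>.\<close>
    have "((\<lambda>r. (K * (r powr (2 * k) * u r) powr (- 1 / k) + c / r\<^sup>2) powr (- k)) \<longlongrightarrow>
        (K * l powr (- 1 / k) + 0) powr (- k)) at_top"
      using l K k_pos
      by (intro tendsto_powr tendsto_add tendsto_mult tendsto_const z
          tendsto_divide_0[OF tendsto_const] filterlim_at_top_imp_at_infinity filterlim_pow_at_top filterlim_ident)
        auto
    moreover have "(K * l powr (- 1 / k) + 0) powr (- k) = K powr (- k) * l"
      using l K k_pos by (simp add: powr_mult powr_powr)
    ultimately have "eventually (\<lambda>r. l' < (K * (r powr (2 * k) * u r) powr (- 1 / k) + c / r\<^sup>2) powr (- k)) at_top"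
      using l'(2) by (intro order_tendstoD(1)) auto
    then show ?thesis using eventually_gt_at_top[of 0]
    proof eventually_elim
      case (elim r)
      have "(r powr (2 * k) * u r) powr (- 1 / k) = w r / r\<^sup>2"
        using elim(2) u_pos[of r] k_pos
        by (simp add: w_def powr_mult powr_powr powr_minus_divide flip: powr_numeral)
      then have "K * (r powr (2 * k) * u r) powr (- 1 / k) + c / r\<^sup>2 = W r / r\<^sup>2"
        by (simp add: W_def add_divide_distrib)
      moreover have "(W r / r\<^sup>2) powr (- k) = v r * r powr (2 * k)"
        using elim(2) W_pos[of r] by (simp add: v_def powr_divide powr_powr powr_minus_divide flip: powr_numeral)
      ultimately have "l' < v r * r powr (2 * k)" using elim(1) by simp
      then have "l' * r powr (- 2 * k) \<le> v r * r powr (2 * k) * r powr (- 2 * k)"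
        by (intro mult_right_mono) auto
      also have "\<dots> = v r" using elim(2) by (simp add: powr_minus)
      finally show ?case .
    qed
  qed
  ultimately show ?thesis by (intro le_ell_star_of_supersolution[of v "c powr (- k)"] l')
qed

lemma le_ell_star_of_singular_decay:
  assumes u: "positive_solution N p u" "filterlim u at_top (at_right 0)" and dec: "decays_to p u l"
  shows "ereal l \<le> ell_star N p"
proof (cases "l > 0")
  case True
  show ?thesis
  proof (rule dense_le)
    fix x assume x: "x < ereal l"
    show "x \<le> ell_star N p"
    proof (cases "x \<le> 0")
      case False
      then obtain l' where l': "x = ereal l'" "0 < l'" "l' < l" using x by (cases x) auto
      \<comment> \<open>\<open>q * l\<close> is the midpoint of \<open>l'\<close> and
        \<open>l\<close>, and \<open>K = q powr (- 1 / k)\<close> satisfies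
        \<open>K powr (- k) = q\<close>.\<close>
      define q where "q = (l + l') / (2 * l)"
      have q: "0 < q" "q < 1" "l' < q * l" using l' by (auto simp: q_def field_simps)
      have "(1::real) < q powr (- 1 / k)"
        using q k_pos powr_less_mono2_neg[of "- 1 / k" q 1] by simp
      moreover have "(q powr (- 1 / k)) powr (- k) = q" using q k_pos by (simp add: powr_powr)
      ultimately show ?thesis
        unfolding l'(1) using q l' by (intro le_ell_star_of_singular_solution[OF u dec True]) auto
    qed (rule order_trans[OF _ ell_star_nonneg])
  qed
next
  case False
  then have "ereal l \<le> 0" by simp
  then show ?thesis using ell_star_nonneg by (rule order_trans)
qed

end

theorem theorem1p3:
  fixes N :: nat and p :: real and u :: "real \<Rightarrow> real"
  assumes "N \<ge> 3"
    and "real N / (real N - 2) \<le> p" and "p \<le> (real N + 2) / (real N - 2)"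
    and "singular_positive_solution N p u"
  shows "\<exists>l. decays_to p u l \<and> 0 \<le> l \<and> ereal l \<le> ell_star N p"
proof -
  interpret ode_params N p using assms(1,2) by unfold_locales
  have u: "positive_solution N p u" "filterlim u at_top (at_right 0)"
    using assms(4) by (auto simp: singular_positive_solution_def)
  obtain l where "decays_to p u l" "0 \<le> l" by (rule positive_solution_decays_to[OF u(1)])
  with le_ell_star_of_singular_decay[OF u] show ?thesis by blast
qed

end
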